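(* Let $\mu\le 0$ and $\alpha\in(0,1)$. Then $$R^*(r)=\frac1\alpha 1_{[0,\alpha)}(r)$$ is the unique normalized reward function maximizing the performance $x_\alpha=x_\alpha(R)$ over all normalized reward functions $R$. The corresponding maximal value is $x_\alpha^*=h^{-1}(1/\alpha)$, and the mean field equilibrium distribution corresponding to $R^*$ has cdf $$F^*=(1-\alpha)1_{[0,x_\alpha^* )}+1_{[x_\alpha^*,\infty)}.$$
   Context: Increasing/decreasing are understood in the non-strict sense. A reward function is a right-continuous decreasing function $R:[0,1]\to[0,\infty)$ with $R(0)>R(1-)=R(1)$. It is normalized if $R(1)=0$ and $\bar R:=\int_0^1R(r)\,dr=1$. Write $g(y):=R(1-y)$. Fix parameters $x_0\in(0,\infty)$, $\mu\in\mathbb R$, $\sigma\in(0,\infty)$. Let $X_t=x_0+\mu t+\sigma W_t$ ($W$ a standard Brownian motion) with absorption at $0$, and $h(x)=\frac{\exp(-2\mu x/\sigma^2)-1}{\exp(-2\mu x_0/\sigma^2)-1}$ if $\mu\ne0$, $h(x)=x/x_0$ if $\mu=0$. $\mathcal F$ is the set of laws on $[0,\infty)$ of $X_\tau$ for some (possibly randomized) finite stopping time $\tau$; for $\mu\le0$ it is known that $\mathcal F$ consists of all distributions $F$ on $[0,\infty)$ with $\int h\,dF\le1$. The same symbol is used for a distribution and its cdf; $F(0-)=0$. For a distribution $F$ on $[0,\infty)$, set $\xi^F(x)=g(F(x))$ if $F(x)=F(x-)$, and $\xi^F(x)=\frac1{F(x)-F(x-)}\int_{F(x-)}^{F(x)}g(y)\,dy$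 if $F(x)>F(x-)$. $F\in\mathcal F$ is a mean field equilibrium (for $R$) if $\int\xi^F\,dF\ge\int\xi^F\,d\tilde F$ for all $\tilde F\in\mathcal F$. For $\mu\le 0$, every reward function $R$ admits a unique mean field equilibrium. Given a normalized reward function $R$ with mean field equilibrium $F$, the performance is $$x_\alpha(R):=F^{-1}((1-\alpha)+)=\inf\{x\ge0:F(x)>1-\alpha\},$$ i.e. the lowest stopping position of the players in the ranks $[0,\alpha)$ (the right-continuous inverse of $F$ at $1-\alpha$). *)

theory Defs
  imports "HOL-Probability.Probability"
begin

section \<open>Brownian motion and attainable laws\<close>

definition history :: "'a measure \<Rightarrow> (real \<Rightarrow> 'a \<Rightarrow> real) \<Rightarrow> real set \<Rightarrow> 'a measure" where
  "history M W T = sigma (space M) {W s -` A \<inter> space M | s A. s \<in> T \<and> A \<in> sets borel}"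

text \<open>Only times \<open>t \<ge> 0\<close> matter; all paths are continuous and start at 0.\<close>

definition standard_brownian_motion :: "'a measure \<Rightarrow> (real \<Rightarrow> 'a \<Rightarrow> real) \<Rightarrow> bool" where
  "standard_brownian_motion M W \<longleftrightarrow>
     prob_space M \<and>
     (\<forall>t\<ge>0. W t \<in> borel_measurable M) \<and>
     (\<forall>\<omega>\<in>space M. W 0 \<omega> = 0) \<and>
     (\<forall>\<omega>\<in>space M. continuous_on {0..} (\<lambda>t. W t \<omega>)) \<and>
     (\<forall>s t. 0 \<le> s \<and> s < t \<longrightarrow>
        distributed M lborel (\<lambda>\<omega>. W t \<omega> - W s \<omega>) (normal_density 0 (sqrt (t - s))) \<and>
        prob_space.indep_set M
          (sets (history M W {0..s}))
          (sets (vimage_algebra (space M) (\<lambda>\<omega>. W t \<omega> - W s \<omega>) borel)))"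

text \<open>An independent uniform variable \<open>U\<close>, revealed at time 0, serves as the randomization device
  for randomized stopping times.\<close>

definition randomizer :: "'a measure \<Rightarrow> (real \<Rightarrow> 'a \<Rightarrow> real) \<Rightarrow> ('a \<Rightarrow> real) \<Rightarrow> bool" where
  "randomizer M W U \<longleftrightarrow>
     U \<in> borel_measurable M \<and>
     distr M borel U = uniform_measure lborel {0..1} \<and>
     prob_space.indep_set M
       (sets (vimage_algebra (space M) U borel)) (sets (history M W {0..}))"

definition randomized_filtration ::
    "'a measure \<Rightarrow> (real \<Rightarrow> 'a \<Rightarrow> real) \<Rightarrow> ('a \<Rightarrow> real) \<Rightarrow> ennreal \<Rightarrow> 'a measure" where
  "randomized_filtration M W U t =
     sigma (space M)
       (sets (vimage_algebra (space M) U borel) \<union>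
        sets (history M W {s. 0 \<le> s \<and> ennreal s \<le> t}))"

definition drifted :: "(real \<Rightarrow> 'a \<Rightarrow> real) \<Rightarrow> real \<Rightarrow> real \<Rightarrow> real \<Rightarrow> real \<Rightarrow> 'a \<Rightarrow> real" where
  "drifted W x0 \<mu> \<sigma> t \<omega> = x0 + \<mu> * t + \<sigma> * W t \<omega>"

definition absorbed :: "(real \<Rightarrow> 'a \<Rightarrow> real) \<Rightarrow> real \<Rightarrow> real \<Rightarrow> real \<Rightarrow> real \<Rightarrow> 'a \<Rightarrow> real" where
  "absorbed W x0 \<mu> \<sigma> t \<omega> =
     (if \<exists>s\<in>{0..t}. drifted W x0 \<mu> \<sigma> s \<omega> = 0 then 0 else drifted W x0 \<mu> \<sigma> t \<omega>)"

text \<open>Stopping times take values in \<open>[0,\<infinity>]\<close> and are required to be finite almost surely; on the null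
  set where the stopping time is infinite, \<open>enn2real\<close> returns 0, which does not affect the law.\<close>

definition attainable_laws ::
    "'a measure \<Rightarrow> (real \<Rightarrow> 'a \<Rightarrow> real) \<Rightarrow> ('a \<Rightarrow> real) \<Rightarrow> real \<Rightarrow> real \<Rightarrow> real \<Rightarrow> real measure set" where
  "attainable_laws M W U x0 \<mu> \<sigma> =
     {distr M borel (\<lambda>\<omega>. absorbed W x0 \<mu> \<sigma> (enn2real (\<tau> \<omega>)) \<omega>) | \<tau> :: 'a \<Rightarrow> ennreal.
        stopping_time (randomized_filtration M W U) \<tau> \<and> (AE \<omega> in M. \<tau> \<omega> < \<infinity>)}"

definition scale_h :: "real \<Rightarrow> real \<Rightarrow> real \<Rightarrow> real \<Rightarrow> real" where
  "scale_h x0 \<mu> \<sigma> x =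
     (if \<mu> = 0 then x / x0
      else (exp (- 2 * \<mu> * x / \<sigma>\<^sup>2) - 1) / (exp (- 2 * \<mu> * x0 / \<sigma>\<^sup>2) - 1))"


section \<open>Rewards and mean field equilibria\<close>

text \<open>Reward functions live on \<open>[0,1]\<close>; values elsewhere are irrelevant.\<close>

definition reward_function :: "(real \<Rightarrow> real) \<Rightarrow> bool" where
  "reward_function R \<longleftrightarrow>
     (\<forall>r\<in>{0..1}. 0 \<le> R r) \<and>
     antimono_on {0..1} R \<and>
     (\<forall>r\<in>{0..<1}. continuous (at_right r) R) \<and>
     (R \<longlongrightarrow> R 1) (at_left 1) \<and>
     R 1 < R 0"

definition normalized_reward :: "(real \<Rightarrow> real) \<Rightarrow> bool" where
  "normalized_reward R \<longleftrightarrow>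
     reward_function R \<and> R 1 = 0 \<and> (LBINT r:{0..1}. R r) = 1"

text \<open>With \<open>g y = R (1 - y)\<close>. For a probability measure \<open>F\<close>, \<open>cdf F x\<close> is \<open>F(x)\<close> and
  \<open>measure F {..<x}\<close> is the left limit \<open>F(x-)\<close>.\<close>

definition expected_reward :: "(real \<Rightarrow> real) \<Rightarrow> real measure \<Rightarrow> real \<Rightarrow> real" where
  "expected_reward R F x =
     (if cdf F x = measure F {..<x} then R (1 - cdf F x)
      else (LBINT y:{measure F {..<x}..cdf F x}. R (1 - y)) / (cdf F x - measure F {..<x}))"

definition mean_field_equilibrium ::
    "real measure set \<Rightarrow> (real \<Rightarrow> real) \<Rightarrow> real measure \<Rightarrow> bool" where
  "mean_field_equilibrium \<F> R F \<longleftrightarrow>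
     F \<in> \<F> \<and>
     (\<forall>F'\<in>\<F>. (\<integral>x. expected_reward R F x \<partial>F') \<le> (\<integral>x. expected_reward R F x \<partial>F))"

text \<open>The performance of a reward function is expressed through its equilibrium \<open>F\<close>.\<close>

definition performance :: "real \<Rightarrow> real measure \<Rightarrow> real" where
  "performance \<alpha> F = Inf {x. 0 \<le> x \<and> 1 - \<alpha> < cdf F x}"

definition maximizes_performance ::
    "real measure set \<Rightarrow> real \<Rightarrow> (real \<Rightarrow> real) \<Rightarrow> bool" where
  "maximizes_performance \<F> \<alpha> R \<longleftrightarrow>
     normalized_reward R \<and>
     (\<exists>F. mean_field_equilibrium \<F> R F) \<and>
     (\<forall>F R' F'. mean_field_equilibrium \<F> R F \<and>
        normalized_reward R' \<and> mean_field_equilibrium \<F> R' F' \<longrightarrow>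
        performance \<alpha> F' \<le> performance \<alpha> F)"

definition optimal_reward :: "real \<Rightarrow> real \<Rightarrow> real" where
  "optimal_reward \<alpha> r = 1 / \<alpha> * indicator {0..<\<alpha>} r"

end

(*
  Since mu <= 0, h(X) is a nonnegative local martingale: every attainable law F satisfies
  int h dF <= 1, and the exit laws from (a,b), a < x0 < b, are attained with equality.

  By Markov's inequality F[x, oo) <= 1/h(x), so at most mass alpha can sit at or above
  xs = h^{-1}(1/alpha), which bounds the performance of every law by xs. Equality forces
  int h dF = 1 with h = h(xs) 1_[xs,oo) F-almost surely, i.e. F = F*. Testing the equilibrium
  property for R* against the exit laws from (0,b) with b < xs shows that its equilibrium is F*.

  If F* is an equilibrium for R, test it against the exit laws from (eps,xs), eps -> 0: the mean
  of R over [alpha,1] is at least R(alpha), so R is constant there and, as R(1-) = 0, it vanishes.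
  The exit laws from (0,b), b decreasing to xs, give R(0) <= 1/alpha, and the normalization
  leaves only R = R*.
*)
theory Submission
  imports Defs
begin

section \<open>Increments and the filtration\<close>

text \<open>The process enters only through two facts about attainable laws: the bound on the
  integral of \<open>h\<close>, and the existence of two-point exit laws whose masses are fixed by
  two linear equations. The reward argument then runs in the locale \<open>exit_laws\<close>, over
  any set of laws with these properties.

  The obstacle on the stochastic side is optional stopping in continuous time. It is proved for the
  exponential martingales \<open>Z\<close>: they are positive, so the martingale step can be done
  with integrals in \<open>ennreal\<close>, and the square of one \<open>Z\<close> is controlled by
  another with doubled parameter, which supplies the uniform integrability. The identity for
  \<open>h\<close> follows: for \<mu> \<noteq> 0, \<open>h\<close> of the process is affine in one
  \<open>Z\<close>; for \<mu> = 0 it comes from the derivative of the family at \<theta> = 0.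

  The limits on the reward side are forced by jumps. Under F* the expected reward may jump at the
  atoms 0 and \<open>xs\<close>, where ranks share an average; only points just above an atom reveal
  the values R(\<alpha>) and R(0).\<close>

locale drifted_motion =
  fixes M :: "'a measure" and W :: "real \<Rightarrow> 'a \<Rightarrow> real" and U :: "'a \<Rightarrow> real"
    and x0 \<mu> \<sigma> :: real
  assumes bm: "standard_brownian_motion M W"
    and rand: "randomizer M W U"
    and x0_pos: "0 < x0" and sigma_pos: "0 < \<sigma>"
begin

sublocale prob_space M
  using bm by (simp add: standard_brownian_motion_def)

abbreviation X :: "real \<Rightarrow> 'a \<Rightarrow> real" where
  "X \<equiv> drifted W x0 \<mu> \<sigma>"

text \<open>Real-indexed view of the filtration: stopping times live in \<open>ennreal\<close>,
  while path arguments run over real times.\<close>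

definition G :: "real \<Rightarrow> 'a measure" where
  "G t = randomized_filtration M W U (ennreal t)"

lemma W_measurable: "0 \<le> t \<Longrightarrow> W t \<in> borel_measurable M"
  using bm by (simp add: standard_brownian_motion_def)

lemma W_0: "\<omega> \<in> space M \<Longrightarrow> W 0 \<omega> = 0"
  using bm by (simp add: standard_brownian_motion_def)

lemma W_continuous: "\<omega> \<in> space M \<Longrightarrow> continuous_on {0..} (\<lambda>t. W t \<omega>)"
  using bm by (simp add: standard_brownian_motion_def)

lemma X_0: "\<omega> \<in> space M \<Longrightarrow> X 0 \<omega> = x0"
  by (simp add: drifted_def W_0)

lemma X_continuous: "\<omega> \<in> space M \<Longrightarrow> continuous_on {0..} (\<lambda>t. X t \<omega>)"
  unfolding drifted_def by (intro continuous_intros W_continuous)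

lemma X_measurable: "0 \<le> t \<Longrightarrow> X t \<in> borel_measurable M"
  unfolding drifted_def[abs_def] using W_measurable[of t] by measurable

lemma increment_distributed:
  "0 \<le> s \<Longrightarrow> s < t \<Longrightarrow>
    distributed M lborel (\<lambda>\<omega>. W t \<omega> - W s \<omega>) (normal_density 0 (sqrt (t - s)))"
  using bm by (simp add: standard_brownian_motion_def)

lemma increment_indep_history:
  "0 \<le> s \<Longrightarrow> s < t \<Longrightarrow>
    indep_set (sets (history M W {0..s}))
      (sets (vimage_algebra (space M) (\<lambda>\<omega>. W t \<omega> - W s \<omega>) borel))"
  using bm by (simp add: standard_brownian_motion_def)

lemma sets_history:
  "sets (history M W T) =
    sigma_sets (space M) {W s -` A \<inter> space M | s A. s \<in> T \<and> A \<in> sets borel}"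
  unfolding history_def by (intro sets_measure_of) auto

lemma space_history [simp]: "space (history M W T) = space M"
  unfolding history_def by (simp add: space_measure_of_conv)

lemma history_mono: "S \<subseteq> T \<Longrightarrow> sets (history M W S) \<subseteq> sets (history M W T)"
  unfolding sets_history by (intro sigma_sets_mono') auto

lemma W_measurable_history: "s \<in> T \<Longrightarrow> W s \<in> borel_measurable (history M W T)"
  by (intro measurableI) (auto simp: sets_history)

lemma space_G [simp]: "space (G t) = space M"
  unfolding G_def randomized_filtration_def by (simp add: space_measure_of_conv)

lemma history_subset: "T \<subseteq> {0..} \<Longrightarrow> sets (history M W T) \<subseteq> events"
  unfolding sets_history using W_measurable
  by (intro sets.sigma_sets_subset) (force intro: measurable_sets)

lemma randomizer_subset: "sets (vimage_algebra (space M) U borel) \<subseteq> events"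
  using rand by (auto simp: randomizer_def sets_vimage_algebra
      intro!: sets.sigma_sets_subset)

lemma sets_filtration:
  "sets (randomized_filtration M W U t) = sigma_sets (space M)
     (sets (vimage_algebra (space M) U borel) \<union> sets (history M W {s. 0 \<le> s \<and> ennreal s \<le> t}))"
  unfolding randomized_filtration_def
  using sets.sets_into_space[of _ "history M W {s. 0 \<le> s \<and> ennreal s \<le> t}"]
    sets.sets_into_space[of _ "vimage_algebra (space M) U borel"]
  by (intro sets_measure_of) auto

lemma sets_filtration_subset: "sets (randomized_filtration M W U t) \<subseteq> events"
  unfolding sets_filtration
  using randomizer_subset history_subset[of "{s. 0 \<le> s \<and> ennreal s \<le> t}"]
  by (intro sets.sigma_sets_subset) auto

lemma space_filtration [simp]: "space (randomized_filtration M W U t) = space M"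
  unfolding randomized_filtration_def by (simp add: space_measure_of_conv)

text \<open>The \<open>max 0 t\<close> appears because \<open>ennreal\<close> sends negative reals
  to 0.\<close>

lemma sets_G:
  "sets (G t) = sigma_sets (space M)
     (sets (vimage_algebra (space M) U borel) \<union> sets (history M W {0..max 0 t}))"
proof -
  have "{s. 0 \<le> s \<and> ennreal s \<le> ennreal t} = {0..max 0 t}"
    by (auto simp: ennreal_le_iff2)
  then show ?thesis by (simp add: G_def sets_filtration)
qed

lemma G_subset: "sets (G t) \<subseteq> events"
  unfolding G_def by (rule sets_filtration_subset)

lemma G_measurable: "f \<in> borel_measurable (G s) \<Longrightarrow> f \<in> borel_measurable M"
  using G_subset[of s] by (auto simp: measurable_def)

lemma W_measurable_G: "0 \<le> s \<Longrightarrow> s \<le> t \<Longrightarrow> W s \<in> borel_measurable (G t)"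
  using W_measurable_history[of s "{0..max 0 t}"] 
  by (auto simp: measurable_def sets_G max_def)

lemma X_measurable_G: "0 \<le> s \<Longrightarrow> s \<le> t \<Longrightarrow> X s \<in> borel_measurable (G t)"
  unfolding drifted_def[abs_def] using W_measurable_G[of s t] by measurable

text \<open>Adding the randomizer to the past does not destroy independence. The sets
  \<open>a \<inter> b\<close> with \<open>a\<close> from \<open>U\<close> and \<open>b\<close> from
  the past form an intersection-stable generator of \<open>G s\<close>. For such a set, first split
  off \<open>a\<close>, which is independent of \<open>b \<inter> d\<close> because \<open>d\<close>
  belongs to the full history, and then separate \<open>b\<close> from \<open>d\<close>.\<close>

lemma increment_indep:
  assumes "0 \<le> s" "s < t"
  shows "indep_set (sets (G s))
    (sets (vimage_algebra (space M) (\<lambda>\<omega>. W t \<omega> - W s \<omega>) borel))"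
proof -
  let ?U = "sets (vimage_algebra (space M) U borel)"
  let ?H = "sets (history M W {0..s})"
  let ?D = "sets (vimage_algebra (space M) (\<lambda>\<omega>. W t \<omega> - W s \<omega>) borel)"
  let ?P = "{a \<inter> b | a b. a \<in> ?U \<and> b \<in> ?H}"
  have HD: "indep_set ?H ?D" by (rule increment_indep_history[OF assms])
  have UH: "indep_set ?U (sets (history M W {0..}))"
    using rand by (simp add: randomizer_def)
  have Usp: "space M \<in> ?U" and Hsp: "space M \<in> ?H"
    using sets.top[of "vimage_algebra (space M) U borel"] sets.top[of "history M W {0..s}"] by simp_all
  have D_hist: "?D \<subseteq> sets (history M W {0..})"
    unfolding sets_vimage_algebra
  proof (rule sets.sigma_sets_subset[of _ "history M W {0..}", simplified])
    have "(\<lambda>\<omega>. W t \<omega> - W s \<omega>) \<in> borel_measurable (history M W {0..})"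
      using assms by (intro borel_measurable_diff W_measurable_history) auto
    then show "{(\<lambda>\<omega>. W t \<omega> - W s \<omega>) -` A \<inter> space M |A. A \<in> sets borel} \<subseteq> sets (history M W {0..})"
      by (auto dest: measurable_sets)
  qed
  have "indep_set ?P ?D"
  proof (rule indep_setI)
    show "?P \<subseteq> events" using randomizer_subset history_subset[of "{0..s}"] by auto
    show "?D \<subseteq> events" using D_hist history_subset[of "{0..}"] by auto
    fix p d assume p: "p \<in> ?P" and d: "d \<in> ?D"
    then obtain a b where ab: "p = a \<inter> b" "a \<in> ?U" "b \<in> ?H" by auto
    have b': "b \<in> sets (history M W {0..})"
      using ab history_mono[of "{0..s}" "{0..}"] by auto
    then have bd: "b \<inter> d \<in> sets (history M W {0..})" using d D_hist by auto
    have "prob (p \<inter> d) = prob (a \<inter> (b \<inter> d))" using ab by (simp add: Int_assoc)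
    also have "\<dots> = prob a * (prob b * prob d)"
      using indep_setD[OF UH ab(2) bd] indep_setD[OF HD ab(3) d] by simp
    also have "\<dots> = prob p * prob d"
      using indep_setD[OF UH ab(2) b'] ab by simp
    finally show "prob (p \<inter> d) = prob p * prob d" .
  qed
  moreover have "Int_stable ?P"
  proof (rule Int_stableI)
    fix p q assume "p \<in> ?P" "q \<in> ?P"
    then obtain a b c d where *: "p = a \<inter> b" "q = c \<inter> d" "a \<in> ?U" "c \<in> ?U" "b \<in> ?H" "d \<in> ?H"
      by auto
    have "p \<inter> q = (a \<inter> c) \<inter> (b \<inter> d)" using * by auto
    moreover have "a \<inter> c \<in> ?U" "b \<inter> d \<in> ?H" using * by auto
    ultimately show "p \<inter> q \<in> ?P" by blast
  qed
  moreover have "Int_stable ?D" by (auto simp: Int_stable_def)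
  ultimately have "indep_set (sigma_sets (space M) ?P) (sigma_sets (space M) ?D)"
    by (rule indep_set_sigma_sets)
  moreover have "sets (G s) \<subseteq> sigma_sets (space M) ?P"
  proof -
    have "?U \<union> ?H \<subseteq> ?P"
    proof
      fix a assume "a \<in> ?U \<union> ?H"
      then have "a \<subseteq> space M" "a = a \<inter> space M \<and> a \<in> ?U \<or> a = space M \<inter> a \<and> a \<in> ?H"
        using sets.sets_into_space[of a "vimage_algebra (space M) U borel"]
          sets.sets_into_space[of a "history M W {0..s}"] by auto
      then show "a \<in> ?P" using Usp Hsp by blast
    qed
    then show ?thesis using assms unfolding sets_G by (simp add: max_def sigma_sets_mono')
  qed
  ultimately show ?thesis
    unfolding indep_set_def
    by (elim indep_sets_mono_sets) (auto split: bool.split)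
qed

text \<open>The joint law of the two factors is the product of their laws, so Tonelli separates the
  integral. Working in \<open>ennreal\<close> allows its use for \<open>Z\<close> before
  integrability is known.\<close>

lemma nn_integral_mult_increment:
  fixes f :: "'a \<Rightarrow> ennreal" and g :: "real \<Rightarrow> ennreal"
  assumes "0 \<le> s" "s < t" and f: "f \<in> borel_measurable (G s)" and g: "g \<in> borel_measurable borel"
  shows "(\<integral>\<^sup>+\<omega>. f \<omega> * g (W t \<omega> - W s \<omega>) \<partial>M) =
    (\<integral>\<^sup>+\<omega>. f \<omega> \<partial>M) * (\<integral>\<^sup>+\<omega>. g (W t \<omega> - W s \<omega>) \<partial>M)"
proof -
  let ?D = "\<lambda>\<omega>. W t \<omega> - W s \<omega>"
  have fM [measurable]: "f \<in> borel_measurable M" using f by (rule G_measurable)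
  have [measurable]: "?D \<in> borel_measurable M"
    using assms by (intro borel_measurable_diff W_measurable) auto
  note g [measurable]
  have "sigma_sets (space M) {f -` A \<inter> space M |A. A \<in> sets borel} \<subseteq> sets (G s)"
    using f measurable_sets[OF f]
    by (intro sets.sigma_sets_subset[of _ "G s", simplified]) auto
  moreover have "sigma_sets (space M) {(\<lambda>\<omega>. g (?D \<omega>)) -` A \<inter> space M |A. A \<in> sets borel}
      \<subseteq> sigma_sets (space M) {?D -` A \<inter> space M |A. A \<in> sets borel}"
    using measurable_sets[OF g] by (intro sigma_sets_mono') (force simp: vimage_def)
  ultimately have "indep_set (sigma_sets (space M) {f -` A \<inter> space M |A. A \<in> sets borel})
      (sigma_sets (space M) {(\<lambda>\<omega>. g (?D \<omega>)) -` A \<inter> space M |A. A \<in> sets borel})"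
    using increment_indep[OF assms(1,2)] unfolding indep_set_def sets_vimage_algebra
    by (elim indep_sets_mono_sets) (auto split: bool.split)
  then have "indep_var borel f borel (\<lambda>\<omega>. g (?D \<omega>))"
    unfolding indep_var_eq by simp
  then have eq: "distr M borel f \<Otimes>\<^sub>M distr M borel (\<lambda>\<omega>. g (?D \<omega>)) =
      distr M (borel \<Otimes>\<^sub>M borel) (\<lambda>\<omega>. (f \<omega>, g (?D \<omega>)))"
    by (simp add: indep_var_distribution_eq)
  interpret D: prob_space "distr M borel (\<lambda>\<omega>. g (?D \<omega>))" by (rule prob_space_distr) measurable
  have "(\<integral>\<^sup>+\<omega>. f \<omega> * g (?D \<omega>) \<partial>M) =
      (\<integral>\<^sup>+z. fst z * snd z \<partial>distr M (borel \<Otimes>\<^sub>M borel) (\<lambda>\<omega>. (f \<omega>, g (?D \<omega>))))"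
    by (subst nn_integral_distr) auto
  also have "\<dots> = (\<integral>\<^sup>+x. \<integral>\<^sup>+y. x * y \<partial>distr M borel (\<lambda>\<omega>. g (?D \<omega>)) \<partial>distr M borel f)"
    unfolding eq[symmetric] by (subst D.nn_integral_fst[symmetric]) auto
  also have "\<dots> = (\<integral>\<^sup>+x. x \<partial>distr M borel f) * (\<integral>\<^sup>+y. y \<partial>distr M borel (\<lambda>\<omega>. g (?D \<omega>)))"
    by (simp add: nn_integral_cmult nn_integral_multc)
  also have "\<dots> = (\<integral>\<^sup>+\<omega>. f \<omega> \<partial>M) * (\<integral>\<^sup>+\<omega>. g (?D \<omega>) \<partial>M)"
    by (simp add: nn_integral_distr)
  finally show ?thesis .
qed

lemma nn_integral_exp_increment:
  assumes "0 \<le> s" "s < t"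
  shows "(\<integral>\<^sup>+\<omega>. ennreal (exp (c * (W t \<omega> - W s \<omega>))) \<partial>M) = ennreal (exp (c\<^sup>2 * (t - s) / 2))"
proof -
  let ?v = "t - s"
  have v: "?v > 0" using assms by simp
  \<comment> \<open>Completing the square: exponential tilting of a centred Gaussian shifts its mean
    to \<open>c * ?v\<close> and leaves the exponential moment as a constant factor.\<close>
  have dens: "exp (c * x) * normal_density 0 (sqrt ?v) x =
      exp (c\<^sup>2 * ?v / 2) * normal_density (c * ?v) (sqrt ?v) x" for x
  proof -
    have "c * x + - (x - 0)\<^sup>2 / (2 * (sqrt ?v)\<^sup>2) =
        c\<^sup>2 * ?v / 2 + - (x - c * ?v)\<^sup>2 / (2 * (sqrt ?v)\<^sup>2)"
      using v by (simp add: field_simps power2_eq_square)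
    then have "exp (c * x) * exp (- (x - 0)\<^sup>2 / (2 * (sqrt ?v)\<^sup>2)) =
        exp (c\<^sup>2 * ?v / 2) * exp (- (x - c * ?v)\<^sup>2 / (2 * (sqrt ?v)\<^sup>2))"
      unfolding exp_add[symmetric] by simp
    then show ?thesis by (simp add: normal_density_def)
  qed
  have "(\<integral>\<^sup>+\<omega>. ennreal (exp (c * (W t \<omega> - W s \<omega>))) \<partial>M) =
      (\<integral>\<^sup>+x. ennreal (normal_density 0 (sqrt ?v) x) * ennreal (exp (c * x)) \<partial>lborel)"
    by (rule distributed_nn_integral[OF increment_distributed[OF assms], symmetric]) simp
  also have "\<dots> = (\<integral>\<^sup>+x. ennreal (exp (c\<^sup>2 * ?v / 2)) * ennreal (normal_density (c * ?v) (sqrt ?v) x) \<partial>lborel)"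
    by (intro nn_integral_cong) (simp add: ennreal_mult'[symmetric] dens[symmetric] mult.commute[of "normal_density _ _ _"])
  also have "\<dots> = ennreal (exp (c\<^sup>2 * ?v / 2)) * (\<integral>\<^sup>+x. ennreal (normal_density (c * ?v) (sqrt ?v) x) \<partial>lborel)"
    by (rule nn_integral_cmult) simp
  also have "(\<integral>\<^sup>+x. ennreal (normal_density (c * ?v) (sqrt ?v) x) \<partial>lborel) = 1"
    using v by (subst nn_integral_eq_integral) auto
  finally show ?thesis by simp
qed

end


section \<open>Optional stopping for exponential martingales\<close>

text \<open>Rounding up, not down, turns stopping times into stopping times. The mesh divides
  \<open>N\<close>, so a time at most \<open>N\<close> is rounded to a time at most
  \<open>N\<close>.\<close>

lemma tendsto_ceiling_grid:
  fixes \<rho> N :: real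
  assumes "0 \<le> \<rho>" "0 < N"
  shows "(\<lambda>n. N / Suc n * real (nat \<lceil>\<rho> / (N / Suc n)\<rceil>)) \<longlonglongrightarrow> \<rho>"
proof -
  have lim: "(\<lambda>n. \<rho> + N / Suc n) \<longlonglongrightarrow> \<rho> + 0"
    by (intro tendsto_intros LIMSEQ_Suc[OF lim_const_over_n])
  have bounds: "\<rho> \<le> d * real (nat \<lceil>\<rho> / d\<rceil>) \<and> d * real (nat \<lceil>\<rho> / d\<rceil>) \<le> \<rho> + d"
    if "0 < d" for d
  proof -
    have "0 \<le> \<rho> / d" using assms that by simp
    then have "real (nat \<lceil>\<rho> / d\<rceil>) = of_int \<lceil>\<rho> / d\<rceil>" by simp
    moreover have "\<rho> / d \<le> of_int \<lceil>\<rho> / d\<rceil>" "of_int \<lceil>\<rho> / d\<rceil> \<le> \<rho> / d + 1" by linarith+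
    ultimately have "\<rho> / d * d \<le> real (nat \<lceil>\<rho> / d\<rceil>) * d"
        "real (nat \<lceil>\<rho> / d\<rceil>) * d \<le> (\<rho> / d + 1) * d"
      using that by (simp_all only: mult_right_mono order.strict_implies_order)
    moreover have "\<rho> / d * d = \<rho>" "(\<rho> / d + 1) * d = \<rho> + d"
      using that by (simp_all add: distrib_right)
    ultimately show ?thesis by (simp only: mult.commute[of d])
  qed
  show ?thesis
    by (rule real_tendsto_sandwich[OF _ _ tendsto_const lim[simplified]])
      (use bounds[of "N / Suc n" for n] assms in \<open>auto intro!: always_eventually\<close>)
qed

context drifted_motion
begin

lemma X_tendsto:
  assumes "\<omega> \<in> space M" "r \<longlonglongrightarrow> t" "0 \<le> t" "\<And>n. 0 \<le> r n"
  shows "(\<lambda>n. X (r n) \<omega>) \<longlonglongrightarrow> X t \<omega>"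
  by (rule continuous_on_tendsto_compose[OF X_continuous[OF assms(1)] assms(2)])
    (use assms in auto)

lemma X_at_grid_measurable:
  fixes \<kappa> :: "'a \<Rightarrow> nat"
  assumes [measurable]: "\<kappa> \<in> measurable M (count_space UNIV)" and "0 \<le> d"
  shows "(\<lambda>\<omega>. X (d * real (\<kappa> \<omega>)) \<omega>) \<in> borel_measurable M"
  using X_measurable \<open>0 \<le> d\<close>
  by (intro measurable_compose_countable[where f="\<lambda>k \<omega>. X (d * real k) \<omega>" and g=\<kappa>]) auto

text \<open>At a grid-valued time only countably many variables \<open>X t\<close> are involved;
  path continuity passes to the limit of fine grids.\<close>

lemma X_at_measurable:
  assumes [measurable]: "\<rho> \<in> borel_measurable M" and nn: "\<And>\<omega>. \<omega> \<in> space M \<Longrightarrow> 0 \<le> \<rho> \<omega>"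
  shows "(\<lambda>\<omega>. X (\<rho> \<omega>) \<omega>) \<in> borel_measurable M"
proof (rule borel_measurable_LIMSEQ_metric)
  show "(\<lambda>\<omega>. X (1 / Suc n * real (nat \<lceil>\<rho> \<omega> / (1 / Suc n)\<rceil>)) \<omega>) \<in> borel_measurable M" for n
    by (rule X_at_grid_measurable) auto
  show "(\<lambda>n. X (1 / Suc n * real (nat \<lceil>\<rho> \<omega> / (1 / Suc n)\<rceil>)) \<omega>) \<longlonglongrightarrow> X (\<rho> \<omega>) \<omega>"
    if "\<omega> \<in> space M" for \<omega>
    by (rule X_tendsto[OF that tendsto_ceiling_grid]) (auto intro!: mult_nonneg_nonneg nn that simp del: times_divide_eq_left)
qed

definition bounded_stop :: "real \<Rightarrow> ('a \<Rightarrow> real) \<Rightarrow> bool" where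
  "bounded_stop N \<rho> \<longleftrightarrow> (\<forall>\<omega>\<in>space M. 0 \<le> \<rho> \<omega> \<and> \<rho> \<omega> \<le> N) \<and>
     (\<forall>t\<ge>0. {\<omega> \<in> space M. \<rho> \<omega> \<le> t} \<in> sets (G t))"

lemma bounded_stop_measurable:
  assumes "bounded_stop N \<rho>"
  shows "\<rho> \<in> borel_measurable M"
proof (rule borel_measurableI_le)
  fix t :: real
  show "{\<omega> \<in> space M. \<rho> \<omega> \<le> t} \<in> events"
  proof (cases "0 \<le> t")
    case True
    then show ?thesis using assms G_subset[of t] by (auto simp: bounded_stop_def)
  next
    case False
    then have "{\<omega> \<in> space M. \<rho> \<omega> \<le> t} = {}"
      using assms by (fastforce simp: bounded_stop_def)
    then show ?thesis by (simp only: sets.empty_sets)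
  qed
qed

text \<open>The exponential martingale of \<open>X\<close>: the subtracted rate is the logarithmic
  exponential moment of \<open>X\<close> per unit of time, at parameter \<theta>.\<close>

definition Z :: "real \<Rightarrow> real \<Rightarrow> 'a \<Rightarrow> real" where
  "Z \<theta> t \<omega> = exp (\<theta> * X t \<omega> - (\<theta> * \<mu> + \<theta>\<^sup>2 * \<sigma>\<^sup>2 / 2) * t)"

lemma Z_nonneg: "0 \<le> Z \<theta> t \<omega>"
  by (simp add: Z_def)

lemma Z_measurable_G: "0 \<le> s \<Longrightarrow> Z \<theta> s \<in> borel_measurable (G s)"
  unfolding Z_def[abs_def] using X_measurable_G[of s s] by measurable

lemma Z_at_measurable:
  assumes [measurable]: "\<rho> \<in> borel_measurable M" and "\<And>\<omega>. \<omega> \<in> space M \<Longrightarrow> 0 \<le> \<rho> \<omega>"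
  shows "(\<lambda>\<omega>. Z \<theta> (\<rho> \<omega>) \<omega>) \<in> borel_measurable M"
  unfolding Z_def using X_at_measurable[OF assms] by measurable

lemma Z_tendsto:
  assumes "\<omega> \<in> space M" "r \<longlonglongrightarrow> t" "0 \<le> t" "\<And>n. 0 \<le> r n"
  shows "(\<lambda>n. Z \<theta> (r n) \<omega>) \<longlonglongrightarrow> Z \<theta> t \<omega>"
  unfolding Z_def by (intro tendsto_intros X_tendsto assms)

text \<open>The martingale property, tested on an event of the past. The ratio of \<open>Z\<close>
  at \<open>t\<close> and at \<open>s\<close> depends on the increment alone, and \<open>?c\<close>
  is the reciprocal of the increment's exponential moment, so the ratio has mean 1.\<close>

lemma nn_integral_Z_step:
  assumes "0 \<le> s" "s < t" and A: "A \<in> sets (G s)"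
  shows "(\<integral>\<^sup>+\<omega>. indicator A \<omega> * ennreal (Z \<theta> t \<omega>) \<partial>M) =
    (\<integral>\<^sup>+\<omega>. indicator A \<omega> * ennreal (Z \<theta> s \<omega>) \<partial>M)"
proof -
  let ?f = "\<lambda>\<omega>. indicator A \<omega> * ennreal (Z \<theta> s \<omega>)"
  let ?c = "exp (- (\<theta> * \<sigma>)\<^sup>2 * (t - s) / 2)"
  let ?g = "\<lambda>x. ennreal ?c * ennreal (exp (\<theta> * \<sigma> * x))"
  have [measurable]: "?f \<in> borel_measurable (G s)"
    using A Z_measurable_G[of s \<theta>] assms by measurable
  have Zt: "Z \<theta> t \<omega> = Z \<theta> s \<omega> * (?c * exp (\<theta> * \<sigma> * (W t \<omega> - W s \<omega>)))" for \<omega>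
    unfolding Z_def drifted_def exp_add[symmetric]
    by (simp add: field_simps power2_eq_square)
  have "ennreal (Z \<theta> t \<omega>) = ennreal (Z \<theta> s \<omega>) * ?g (W t \<omega> - W s \<omega>)" for \<omega>
    unfolding Zt by (simp only: ennreal_mult Z_nonneg exp_ge_zero mult_nonneg_nonneg)
  then have "(\<integral>\<^sup>+\<omega>. indicator A \<omega> * ennreal (Z \<theta> t \<omega>) \<partial>M) =
      (\<integral>\<^sup>+\<omega>. ?f \<omega> * ?g (W t \<omega> - W s \<omega>) \<partial>M)"
    by (simp only: mult.assoc)
  also have "\<dots> = (\<integral>\<^sup>+\<omega>. ?f \<omega> \<partial>M) * (\<integral>\<^sup>+\<omega>. ?g (W t \<omega> - W s \<omega>) \<partial>M)"
    by (rule nn_integral_mult_increment[OF assms(1,2)]) measurable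
  also have "(\<integral>\<^sup>+\<omega>. ?g (W t \<omega> - W s \<omega>) \<partial>M) =
      ennreal ?c * (\<integral>\<^sup>+\<omega>. ennreal (exp (\<theta> * \<sigma> * (W t \<omega> - W s \<omega>))) \<partial>M)"
    using assms
    by (intro nn_integral_cmult measurable_compose[OF borel_measurable_diff[OF W_measurable W_measurable]]) auto
  also have "\<dots> = ennreal (?c * exp ((\<theta> * \<sigma>)\<^sup>2 * (t - s) / 2))"
    by (simp add: nn_integral_exp_increment[OF assms(1,2)] ennreal_mult'')
  also have "?c * exp ((\<theta> * \<sigma>)\<^sup>2 * (t - s) / 2) = 1"
    unfolding exp_add[symmetric] by simp
  finally show ?thesis by simp
qed

text \<open>Discrete optional stopping. Raising the cap from \<open>j\<close> to
  \<open>Suc j\<close> changes the integrand only where \<open>\<kappa>\<close> exceeds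
  \<open>j\<close>, an event known at time \<open>d * real j\<close>, and there the martingale step
  applies.\<close>

lemma nn_integral_Z_grid:
  fixes \<kappa> :: "'a \<Rightarrow> nat"
  assumes d: "0 < d" and \<kappa>: "\<And>j. {\<omega> \<in> space M. \<kappa> \<omega> \<le> j} \<in> sets (G (d * real j))"
  shows "(\<integral>\<^sup>+\<omega>. ennreal (Z \<theta> (d * real (min j (\<kappa> \<omega>))) \<omega>) \<partial>M) = ennreal (exp (\<theta> * x0))"
proof (induction j)
  case 0
  have "(\<integral>\<^sup>+\<omega>. ennreal (Z \<theta> (d * real (min 0 (\<kappa> \<omega>))) \<omega>) \<partial>M) =
      (\<integral>\<^sup>+\<omega>. ennreal (exp (\<theta> * x0)) \<partial>M)"
    by (intro nn_integral_cong) (simp add: Z_def X_0)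
  then show ?case by (simp add: emeasure_space_1)
next
  case (Suc j)
  let ?A = "{\<omega> \<in> space M. \<kappa> \<omega> \<le> j}" and ?B = "{\<omega> \<in> space M. j < \<kappa> \<omega>}"
  have B: "?B \<in> sets (G (d * real j))"
  proof -
    have "?B = space (G (d * real j)) - ?A" by auto
    then show ?thesis using \<kappa>[of j] by (simp only: sets.compl_sets)
  qed
  have [measurable]: "?A \<in> events" "?B \<in> events"
    using B \<kappa> G_subset by blast+
  have [measurable]: "\<kappa> \<in> measurable M (count_space UNIV)"
  proof (rule measurable_count_space_eq2_countable[THEN iffD2], safe)
    fix k
    have "{\<omega> \<in> space M. \<kappa> \<omega> \<le> j} \<in> events" for j using \<kappa> G_subset by blast
    from this[of k] this[of "k - 1"]
    \<comment> \<open>The case \<open>k = 0\<close> is separate because \<open>0 - 1 = 0\<close> on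
      naturals: the difference would be empty.\<close>
    have "{\<omega> \<in> space M. \<kappa> \<omega> \<le> k} - (if k = 0 then {} else {\<omega> \<in> space M. \<kappa> \<omega> \<le> k - 1}) \<in> events"
      by auto
    also have "{\<omega> \<in> space M. \<kappa> \<omega> \<le> k} - (if k = 0 then {} else {\<omega> \<in> space M. \<kappa> \<omega> \<le> k - 1}) =
        \<kappa> -` {k} \<inter> space M"
      by auto
    finally show "\<kappa> -` {k} \<inter> space M \<in> events" .
  qed auto
  have [measurable]: "(\<lambda>\<omega>. Z \<theta> (d * real (\<kappa> \<omega>)) \<omega>) \<in> borel_measurable M"
    using d by (intro Z_at_measurable) auto
  have [measurable]: "Z \<theta> (d * real k) \<in> borel_measurable M" for k
    using d by (intro G_measurable[OF Z_measurable_G]) auto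
  \<comment> \<open>For both values of \<open>i\<close>, \<open>min i (\<kappa> \<omega>)\<close> is
    \<open>\<kappa> \<omega>\<close> on \<open>?A\<close> and \<open>i\<close> on \<open>?B\<close>,
    so the two integrals differ only in the second summand.\<close>
  have split: "(\<integral>\<^sup>+\<omega>. ennreal (Z \<theta> (d * real (min i (\<kappa> \<omega>))) \<omega>) \<partial>M) =
      (\<integral>\<^sup>+\<omega>. indicator ?A \<omega> * ennreal (Z \<theta> (d * real (\<kappa> \<omega>)) \<omega>) \<partial>M) +
      (\<integral>\<^sup>+\<omega>. indicator ?B \<omega> * ennreal (Z \<theta> (d * real i) \<omega>) \<partial>M)"
    if "i = j \<or> i = Suc j" for i
  proof -
    have "(\<integral>\<^sup>+\<omega>. ennreal (Z \<theta> (d * real (min i (\<kappa> \<omega>))) \<omega>) \<partial>M) =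
        (\<integral>\<^sup>+\<omega>. indicator ?A \<omega> * ennreal (Z \<theta> (d * real (\<kappa> \<omega>)) \<omega>) +
          indicator ?B \<omega> * ennreal (Z \<theta> (d * real i) \<omega>) \<partial>M)"
      using that by (intro nn_integral_cong) (auto simp: indicator_def min_def not_le le_Suc_eq)
    also have "\<dots> = (\<integral>\<^sup>+\<omega>. indicator ?A \<omega> * ennreal (Z \<theta> (d * real (\<kappa> \<omega>)) \<omega>) \<partial>M) +
      (\<integral>\<^sup>+\<omega>. indicator ?B \<omega> * ennreal (Z \<theta> (d * real i) \<omega>) \<partial>M)"
      by (rule nn_integral_add) measurable
    finally show ?thesis .
  qed
  have "(\<integral>\<^sup>+\<omega>. indicator ?B \<omega> * ennreal (Z \<theta> (d * real (Suc j)) \<omega>) \<partial>M) =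
      (\<integral>\<^sup>+\<omega>. indicator ?B \<omega> * ennreal (Z \<theta> (d * real j) \<omega>) \<partial>M)"
    using d by (intro nn_integral_Z_step B) (auto simp: field_simps)
  then show ?case using split[of j] split[of "Suc j"] Suc.IH by simp
qed

text \<open>The grid index of the rounded time is at most \<open>j\<close> exactly when
  \<open>\<rho>\<close> is at most the \<open>j\<close>-th grid point, an event known at that point.
  The index never exceeds \<open>Suc n\<close>, so the cap \<open>Suc n\<close> in the discrete
  identity has no effect.\<close>

lemma bounded_stop_grid:
  assumes \<rho>: "bounded_stop N \<rho>" and N: "0 < N"
  defines "r \<equiv> \<lambda>n \<omega>. N / Suc n * real (nat \<lceil>\<rho> \<omega> / (N / Suc n)\<rceil>)"
  shows "(\<integral>\<^sup>+\<omega>. ennreal (Z \<theta> (r n \<omega>) \<omega>) \<partial>M) = ennreal (exp (\<theta> * x0))"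
    and "\<omega> \<in> space M \<Longrightarrow> 0 \<le> r n \<omega>" "\<omega> \<in> space M \<Longrightarrow> r n \<omega> \<le> N"
    and "\<omega> \<in> space M \<Longrightarrow> (\<lambda>n. r n \<omega>) \<longlonglongrightarrow> \<rho> \<omega>"
    and "r n \<in> borel_measurable M"
proof -
  let ?d = "N / Suc n"
  have \<rho>_bounds: "\<And>\<omega>. \<omega> \<in> space M \<Longrightarrow> 0 \<le> \<rho> \<omega> \<and> \<rho> \<omega> \<le> N"
    using \<rho> by (auto simp: bounded_stop_def)
  have d: "0 < ?d" using N by simp
  have \<kappa>_le: "nat \<lceil>\<rho> \<omega> / ?d\<rceil> \<le> Suc n" if "\<omega> \<in> space M" for \<omega>
  proof -
    have "\<rho> \<omega> / ?d \<le> real (Suc n)"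
      using \<rho>_bounds[OF that] by (subst pos_divide_le_eq[OF d]) (simp del: of_nat_Suc)
    then have "\<lceil>\<rho> \<omega> / ?d\<rceil> \<le> int (Suc n)" by (simp only: ceiling_le_iff of_int_of_nat_eq)
    then show ?thesis by (simp only: nat_le_iff)
  qed
  show "\<omega> \<in> space M \<Longrightarrow> 0 \<le> r n \<omega>" unfolding r_def using N by simp
  show "r n \<omega> \<le> N" if "\<omega> \<in> space M"
  proof -
    have "?d * real (nat \<lceil>\<rho> \<omega> / ?d\<rceil>) \<le> ?d * real (Suc n)"
      using \<kappa>_le[OF that] d by (intro mult_left_mono) (auto simp del: of_nat_Suc)
    then show ?thesis by (simp add: r_def del: of_nat_Suc)
  qed
  show "\<omega> \<in> space M \<Longrightarrow> (\<lambda>n. r n \<omega>) \<longlonglongrightarrow> \<rho> \<omega>"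
    unfolding r_def using \<rho>_bounds N by (intro tendsto_ceiling_grid) auto
  show "r n \<in> borel_measurable M"
    unfolding r_def[abs_def] using bounded_stop_measurable[OF \<rho>] by measurable
  have \<kappa>: "{\<omega> \<in> space M. nat \<lceil>\<rho> \<omega> / ?d\<rceil> \<le> j} \<in> sets (G (?d * real j))" for j
  proof -
    have "{\<omega> \<in> space M. nat \<lceil>\<rho> \<omega> / ?d\<rceil> \<le> j} = {\<omega> \<in> space M. \<rho> \<omega> \<le> ?d * real j}"
      by (simp only: nat_le_iff ceiling_le_iff of_int_of_nat_eq pos_divide_le_eq[OF d] mult.commute)
    moreover have "0 \<le> ?d * real j" using N by simp
    ultimately show ?thesis using \<rho> by (simp only: bounded_stop_def)
  qed
  have "(\<integral>\<^sup>+\<omega>. ennreal (Z \<theta> (r n \<omega>) \<omega>) \<partial>M) =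
      (\<integral>\<^sup>+\<omega>. ennreal (Z \<theta> (?d * real (min (Suc n) (nat \<lceil>\<rho> \<omega> / ?d\<rceil>))) \<omega>) \<partial>M)"
    by (intro nn_integral_cong) (simp only: r_def min.absorb2[OF \<kappa>_le])
  then show "(\<integral>\<^sup>+\<omega>. ennreal (Z \<theta> (r n \<omega>) \<omega>) \<partial>M) = ennreal (exp (\<theta> * x0))"
    by (simp only: nn_integral_Z_grid[OF d \<kappa>])
qed

text \<open>Fatou along the grid approximations gives integrability and one inequality. The other
  needs that no mass escapes in the limit: the truncated variables converge by dominated
  convergence, and the truncation error is bounded by \<open>C / K\<close> uniformly in
  \<open>n\<close>.\<close>

lemma optional_stopping_exp:
  assumes \<rho>: "bounded_stop N \<rho>" and N: "0 < N"
  shows "integrable M (\<lambda>\<omega>. Z \<theta> (\<rho> \<omega>) \<omega>)"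
    and "expectation (\<lambda>\<omega>. Z \<theta> (\<rho> \<omega>) \<omega>) = exp (\<theta> * x0)"
proof -
  define r where "r n \<omega> = N / Suc n * real (nat \<lceil>\<rho> \<omega> / (N / Suc n)\<rceil>)" for n \<omega>
  note grid = bounded_stop_grid[OF \<rho> N, folded r_def]
  have [measurable]: "(\<lambda>\<omega>. Z \<theta> (r n \<omega>) \<omega>) \<in> borel_measurable M" for n \<theta>
    using grid by (intro Z_at_measurable)
  have [measurable]: "(\<lambda>\<omega>. Z \<theta> (\<rho> \<omega>) \<omega>) \<in> borel_measurable M"
    using \<rho> by (intro Z_at_measurable bounded_stop_measurable[OF \<rho>]) (auto simp: bounded_stop_def)
  have lim: "(\<lambda>n. Z \<theta> (r n \<omega>) \<omega>) \<longlonglongrightarrow> Z \<theta> (\<rho> \<omega>) \<omega>" if "\<omega> \<in> space M" for \<omega>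
    using \<rho> grid that by (intro Z_tendsto) (auto simp: bounded_stop_def)
  have "(\<integral>\<^sup>+\<omega>. ennreal (Z \<theta> (\<rho> \<omega>) \<omega>) \<partial>M) =
      (\<integral>\<^sup>+\<omega>. liminf (\<lambda>n. ennreal (Z \<theta> (r n \<omega>) \<omega>)) \<partial>M)"
    using lim by (intro nn_integral_cong lim_imp_Liminf[symmetric] tendsto_ennrealI) auto
  also have "\<dots> \<le> liminf (\<lambda>n. \<integral>\<^sup>+\<omega>. ennreal (Z \<theta> (r n \<omega>) \<omega>) \<partial>M)"
    by (rule nn_integral_liminf) measurable
  also have "\<dots> = ennreal (exp (\<theta> * x0))"
    by (simp add: grid(1) Liminf_const)
  finally have upper: "(\<integral>\<^sup>+\<omega>. ennreal (Z \<theta> (\<rho> \<omega>) \<omega>) \<partial>M) \<le> ennreal (exp (\<theta> * x0))" .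
  then show int: "integrable M (\<lambda>\<omega>. Z \<theta> (\<rho> \<omega>) \<omega>)"
    by (intro integrableI_nonneg) (auto simp: Z_nonneg intro: le_less_trans)
  have "ennreal (expectation (\<lambda>\<omega>. Z \<theta> (\<rho> \<omega>) \<omega>)) \<le> ennreal (exp (\<theta> * x0))"
    using upper by (simp add: nn_integral_eq_integral[OF int] Z_nonneg)
  then have le: "expectation (\<lambda>\<omega>. Z \<theta> (\<rho> \<omega>) \<omega>) \<le> exp (\<theta> * x0)" by simp
  have grid_int: "integrable M (\<lambda>\<omega>. Z \<theta> (r n \<omega>) \<omega>)"
    and grid_exp: "expectation (\<lambda>\<omega>. Z \<theta> (r n \<omega>) \<omega>) = exp (\<theta> * x0)" for n \<theta>
  proof -
    show "integrable M (\<lambda>\<omega>. Z \<theta> (r n \<omega>) \<omega>)"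
      by (intro integrableI_nonneg) (auto simp: Z_nonneg grid(1))
    show "expectation (\<lambda>\<omega>. Z \<theta> (r n \<omega>) \<omega>) = exp (\<theta> * x0)"
      by (rule integral_eq_nn_integral[THEN trans]) (auto simp: Z_nonneg grid(1))
  qed
  (* Z^2 is dominated by a multiple of the exponential martingale with parameter 2 theta, so the family is
     bounded in L2; z <= min K z + z^2 / K turns this into the missing lower bound. *)
  define C where "C = exp (\<theta>\<^sup>2 * \<sigma>\<^sup>2 * N) * exp (2 * \<theta> * x0)"
  have trunc: "exp (\<theta> * x0) - C / K \<le> expectation (\<lambda>\<omega>. min K (Z \<theta> (r n \<omega>) \<omega>))"
    if K: "0 < K" for K n
  proof -
    have pt: "Z \<theta> (r n \<omega>) \<omega> \<le> min K (Z \<theta> (r n \<omega>) \<omega>) + exp (\<theta>\<^sup>2 * \<sigma>\<^sup>2 * N) / K * Z (2 * \<theta>) (r n \<omega>) \<omega>"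
      if \<omega>: "\<omega> \<in> space M" for \<omega>
    proof -
      let ?z = "Z \<theta> (r n \<omega>) \<omega>"
      have "?z\<^sup>2 = Z (2 * \<theta>) (r n \<omega>) \<omega> * exp (\<theta>\<^sup>2 * \<sigma>\<^sup>2 * r n \<omega>)"
        unfolding Z_def exp_add[symmetric] exp_double[symmetric]
        by (simp add: field_simps power2_eq_square)
      also have "\<dots> \<le> Z (2 * \<theta>) (r n \<omega>) \<omega> * exp (\<theta>\<^sup>2 * \<sigma>\<^sup>2 * N)"
        using grid(3)[OF \<omega>] by (intro mult_left_mono) (auto simp: Z_nonneg intro: mult_left_mono)
      finally have sq: "?z\<^sup>2 \<le> exp (\<theta>\<^sup>2 * \<sigma>\<^sup>2 * N) * Z (2 * \<theta>) (r n \<omega>) \<omega>" by (simp add: mult.commute)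
      have "?z \<le> min K ?z + ?z\<^sup>2 / K"
      proof (cases "?z \<le> K")
        case False
        then have "K * ?z \<le> ?z\<^sup>2" using Z_nonneg[of \<theta>] by (simp add: power2_eq_square mult_right_mono)
        then have "?z \<le> ?z\<^sup>2 / K" using K by (simp add: field_simps)
        then show ?thesis using False K by simp
      qed (use K in simp)
      also have "\<dots> \<le> min K ?z + exp (\<theta>\<^sup>2 * \<sigma>\<^sup>2 * N) * Z (2 * \<theta>) (r n \<omega>) \<omega> / K"
        using sq K by (intro add_left_mono divide_right_mono) auto
      finally show ?thesis by simp
    qed
    have intK: "integrable M (\<lambda>\<omega>. min K (Z \<theta> (r n \<omega>) \<omega>))"
      using grid_int[of \<theta> n] by (intro integrable_min) auto
    have "exp (\<theta> * x0) = expectation (\<lambda>\<omega>. Z \<theta> (r n \<omega>) \<omega>)" by (simp add: grid_exp)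
    also have "\<dots> \<le> expectation (\<lambda>\<omega>. min K (Z \<theta> (r n \<omega>) \<omega>) +
        exp (\<theta>\<^sup>2 * \<sigma>\<^sup>2 * N) / K * Z (2 * \<theta>) (r n \<omega>) \<omega>)"
      by (intro integral_mono pt Bochner_Integration.integrable_add integrable_mult_right intK grid_int)
    also have "\<dots> = expectation (\<lambda>\<omega>. min K (Z \<theta> (r n \<omega>) \<omega>)) + C / K"
      by (subst Bochner_Integration.integral_add)
        (auto intro!: intK integrable_mult_right grid_int simp: grid_exp C_def)
    finally show ?thesis by simp
  qed
  have trunc_lim: "exp (\<theta> * x0) - C / K \<le> expectation (\<lambda>\<omega>. Z \<theta> (\<rho> \<omega>) \<omega>)" if K: "0 < K" for K
  proof -
    have "(\<lambda>n. expectation (\<lambda>\<omega>. min K (Z \<theta> (r n \<omega>) \<omega>))) \<longlonglongrightarrow>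
        expectation (\<lambda>\<omega>. min K (Z \<theta> (\<rho> \<omega>) \<omega>))"
      using K lim by (intro integral_dominated_convergence[where w="\<lambda>_. K"])
        (auto intro!: tendsto_intros AE_I2 simp: Z_nonneg)
    then have "exp (\<theta> * x0) - C / K \<le> expectation (\<lambda>\<omega>. min K (Z \<theta> (\<rho> \<omega>) \<omega>))"
      using trunc[OF K] by (intro LIMSEQ_le_const) auto
    also have "\<dots> \<le> expectation (\<lambda>\<omega>. Z \<theta> (\<rho> \<omega>) \<omega>)"
      using int by (intro integral_mono integrable_min) auto
    finally show ?thesis .
  qed
  have "exp (\<theta> * x0) \<le> expectation (\<lambda>\<omega>. Z \<theta> (\<rho> \<omega>) \<omega>)"
  proof (rule field_le_epsilon)
    fix e :: real assume e: "0 < e"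
    have "0 < C / e" "C / (C / e) = e" using e by (auto simp: C_def)
    then show "exp (\<theta> * x0) \<le> expectation (\<lambda>\<omega>. Z \<theta> (\<rho> \<omega>) \<omega>) + e"
      using trunc_lim[of "C / e"] by simp
  qed
  with le show "expectation (\<lambda>\<omega>. Z \<theta> (\<rho> \<omega>) \<omega>) = exp (\<theta> * x0)" by simp
qed

end


section \<open>Hitting times and the scale function\<close>

text \<open>The first zero capped at \<open>c\<close>. Putting \<open>c\<close> into the set keeps
  it nonempty and makes the result a bounded time even for paths without a zero.\<close>

definition first_zero :: "(real \<Rightarrow> real) \<Rightarrow> real \<Rightarrow> real" where
  "first_zero y c = Inf ({s. 0 \<le> s \<and> y s = 0} \<union> {c})"

lemma first_zero:
  assumes y: "continuous_on {0..} y" and c: "0 \<le> c"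
  shows "0 \<le> first_zero y c" "first_zero y c \<le> c"
    and "0 \<le> s \<Longrightarrow> s < first_zero y c \<Longrightarrow> y s \<noteq> 0"
    and "first_zero y c = c \<or> y (first_zero y c) = 0"
    and "first_zero y c \<le> t \<longleftrightarrow> (\<exists>s\<in>{0..t}. y s = 0) \<or> c \<le> t"
proof -
  let ?S = "{s. 0 \<le> s \<and> y s = 0} \<union> {c}"
  have "closed {s \<in> {0..}. y s = 0}"
    by (intro continuous_closed_preimage_constant y closed_atLeast)
  then have "closed ?S" by simp
  moreover have bdd: "bdd_below ?S" using c by (intro bdd_belowI[of _ 0]) auto
  ultimately have "first_zero y c \<in> ?S" unfolding first_zero_def by (intro closed_contains_Inf) auto
  then have mem: "0 \<le> first_zero y c \<and> y (first_zero y c) = 0 \<or> first_zero y c = c" by auto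
  then show "0 \<le> first_zero y c" "first_zero y c = c \<or> y (first_zero y c) = 0" using c by auto
  have lower: "first_zero y c \<le> s" if "s \<in> ?S" for s
    unfolding first_zero_def by (rule cInf_lower[OF that bdd])
  then show "first_zero y c \<le> c" by simp
  show "y s \<noteq> 0" if "0 \<le> s" "s < first_zero y c" using lower[of s] that by auto
  show "first_zero y c \<le> t \<longleftrightarrow> (\<exists>s\<in>{0..t}. y s = 0) \<or> c \<le> t"
    using mem lower by fastforce
qed

text \<open>Intermediate value theorem. The point \<open>r\<close> may itself be a zero, which is
  the case at a hitting time.\<close>

lemma no_zero_pos:
  fixes y :: "real \<Rightarrow> real"
  assumes y: "continuous_on {0..} y" and "0 < y 0" "0 \<le> r" and nz: "\<And>s. 0 \<le> s \<Longrightarrow> s < r \<Longrightarrow> y s \<noteq> 0"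
  shows "0 \<le> y r"
proof (rule ccontr)
  assume "\<not> 0 \<le> y r"
  then obtain s where "0 \<le> s" "s \<le> r" "y s = 0"
    using IVT2'[of y r 0 0] assms continuous_on_subset[OF y, of "{0..r}"] by force
  then show False using nz[of s] \<open>\<not> 0 \<le> y r\<close> by (cases "s = r") auto
qed

text \<open>Replaces an uncountable quantifier by countable ones, for measurability. Forwards,
  rationals to the right of a zero are used, and \<open>t\<close> is adjoined for a zero at the end
  point. Backwards, the absolute value attains its minimum on the compact interval, and that minimum
  lies below every \<open>1 / Suc k\<close>.\<close>

lemma zero_iff_approx:
  fixes y :: "real \<Rightarrow> real"
  assumes y: "continuous_on {0..} y" and t: "0 \<le> t"
  shows "(\<exists>s\<in>{0..t}. y s = 0) \<longleftrightarrow>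
    (\<forall>k::nat. \<exists>s\<in>insert t ({0..t} \<inter> \<rat>). \<bar>y s\<bar> < 1 / Suc k)"
proof
  assume "\<exists>s\<in>{0..t}. y s = 0"
  then obtain u where u: "0 \<le> u" "u \<le> t" "y u = 0" by auto
  show "\<forall>k::nat. \<exists>s\<in>insert t ({0..t} \<inter> \<rat>). \<bar>y s\<bar> < 1 / Suc k"
  proof
    fix k :: nat
    have "0 < 1 / real (Suc k)" by simp
    then obtain d where d: "d > 0" "\<And>s. s \<ge> 0 \<Longrightarrow> dist s u < d \<Longrightarrow> dist (y s) (y u) < 1 / Suc k"
      using y u unfolding continuous_on_iff by (metis atLeast_iff)
    show "\<exists>s\<in>insert t ({0..t} \<inter> \<rat>). \<bar>y s\<bar> < 1 / Suc k"
    proof (cases "u = t")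
      case False
      then obtain q where "q \<in> \<rat>" "u < q" "q < min t (u + d)"
        using Rats_dense_in_real[of u "min t (u + d)"] u d by auto
      then show ?thesis using d(2)[of q] u by (intro bexI[of _ q]) (auto simp: dist_real_def)
    qed (use u in simp)
  qed
next
  assume approx: "\<forall>k::nat. \<exists>s\<in>insert t ({0..t} \<inter> \<rat>). \<bar>y s\<bar> < 1 / Suc k"
  have "continuous_on {0..t} (\<lambda>s. \<bar>y s\<bar>)"
    by (intro continuous_intros continuous_on_subset[OF y]) auto
  then obtain m where m: "m \<in> {0..t}" "\<And>s. s \<in> {0..t} \<Longrightarrow> \<bar>y m\<bar> \<le> \<bar>y s\<bar>"
    using continuous_attains_inf[of "{0..t}" "\<lambda>s. \<bar>y s\<bar>"] t by auto
  have "\<bar>y m\<bar> < 1 / Suc k" for k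
  proof -
    obtain s where "s \<in> insert t ({0..t} \<inter> \<rat>)" "\<bar>y s\<bar> < 1 / Suc k" using approx by blast
    then show ?thesis using m(2)[of s] t by auto
  qed
  then have "\<not> 0 < \<bar>y m\<bar>" by (meson nat_approx_posE not_less_iff_gr_or_eq)
  then show "\<exists>s\<in>{0..t}. y s = 0" using m(1) by auto
qed

section \<open>The scale function: monotonicity, continuity, range\<close>

lemma scale_h_0: "scale_h x0 \<mu> \<sigma> 0 = 0"
  by (simp add: scale_h_def)

lemma scale_h_x0:
  assumes "0 < x0" "0 < \<sigma>"
  shows "scale_h x0 \<mu> \<sigma> x0 = 1"
  using assms by (simp add: scale_h_def)

lemma scale_h_strict_mono:
  assumes "0 < x0" "0 < \<sigma>" "\<mu> \<le> 0"
  shows "strict_mono (scale_h x0 \<mu> \<sigma>)"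
proof (rule strict_monoI)
  fix x y :: real assume xy: "x < y"
  show "scale_h x0 \<mu> \<sigma> x < scale_h x0 \<mu> \<sigma> y"
  proof (cases "\<mu> = 0")
    case False
    then have "\<mu> < 0" using assms by simp
    then have "- 2 * \<mu> * x / \<sigma>\<^sup>2 < - 2 * \<mu> * y / \<sigma>\<^sup>2" "0 < - 2 * \<mu> * x0 / \<sigma>\<^sup>2"
      using assms xy by (auto intro!: divide_strict_right_mono simp: mult_less_cancel_left divide_less_0_iff mult_less_0_iff)
    then show ?thesis
      using False unfolding scale_h_def by (auto intro!: divide_strict_right_mono)
  qed (use assms xy in \<open>simp add: scale_h_def divide_strict_right_mono\<close>)
qed

lemma scale_h_continuous:
  assumes "0 < x0" "0 < \<sigma>"
  shows "continuous_on A (scale_h x0 \<mu> \<sigma>)"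
  using assms unfolding scale_h_def[abs_def]
  by (cases "\<mu> = 0") (auto intro!: continuous_intros)

text \<open>Here the sign of the drift matters: for \<mu> > 0 the scale function is bounded and a
  level such as 1/\<alpha> may be out of reach. For \<mu> < 0 the exponential is inverted
  explicitly.\<close>

lemma scale_h_surj:
  assumes "0 < x0" "0 < \<sigma>" "\<mu> \<le> 0" "0 \<le> y"
  shows "\<exists>x\<ge>0. scale_h x0 \<mu> \<sigma> x = y"
proof (cases "\<mu> = 0")
  case True
  then show ?thesis using assms by (intro exI[of _ "y * x0"]) (simp add: scale_h_def)
next
  case False
  define \<theta> where "\<theta> = - 2 * \<mu> / \<sigma>\<^sup>2"
  have \<theta>: "0 < \<theta>" using False assms by (simp add: \<theta>_def zero_less_divide_iff divide_less_0_iff mult_less_0_iff)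
  then have e: "0 < exp (\<theta> * x0) - 1" using assms by simp
  define u where "u = y * (exp (\<theta> * x0) - 1)"
  have u: "0 \<le> u" using e assms unfolding u_def by (intro mult_nonneg_nonneg) auto
  have h: "scale_h x0 \<mu> \<sigma> x = (exp (\<theta> * x) - 1) / (exp (\<theta> * x0) - 1)" for x
    using False by (simp add: scale_h_def \<theta>_def)
  show ?thesis
  proof (intro exI conjI)
    show "0 \<le> ln (1 + u) / \<theta>" using \<theta> u by simp
    have "exp (\<theta> * (ln (1 + u) / \<theta>)) - 1 = u" using \<theta> u by simp
    moreover have "exp (\<theta> * x0) - 1 \<noteq> 0"
      using less_imp_neq[OF e] by (rule not_sym)
    ultimately show "scale_h x0 \<mu> \<sigma> (ln (1 + u) / \<theta>) = y"
      unfolding h u_def by (simp only: nonzero_mult_div_cancel_right not_False_eq_True)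
  qed
qed

section \<open>Hitting times as stopping times, and the attainable laws\<close>

context drifted_motion
begin

abbreviation h :: "real \<Rightarrow> real" where
  "h \<equiv> scale_h x0 \<mu> \<sigma>"

lemma h_measurable [measurable]: "h \<in> borel_measurable borel"
  using scale_h_continuous[OF x0_pos sigma_pos] by (intro borel_measurable_continuous_onI)

lemma zero_hit_measurable:
  fixes Y :: "real \<Rightarrow> 'a \<Rightarrow> real"
  assumes paths: "\<And>\<omega>. \<omega> \<in> space M \<Longrightarrow> continuous_on {0..} (\<lambda>t. Y t \<omega>)"
    and adapted: "\<And>s. 0 \<le> s \<Longrightarrow> s \<le> t \<Longrightarrow> Y s \<in> borel_measurable (G t)"
    and t: "0 \<le> t"
  shows "{\<omega> \<in> space M. \<exists>s\<in>{0..t}. Y s \<omega> = 0} \<in> sets (G t)"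
proof -
  let ?Q = "insert t ({0..t} \<inter> \<rat>)"
  have "countable ?Q" by (intro countable_insert countable_Int2 countable_rat)
  have "{\<omega> \<in> space M. \<exists>s\<in>{0..t}. Y s \<omega> = 0} =
      {\<omega> \<in> space M. \<forall>k::nat. \<exists>s\<in>?Q. \<bar>Y s \<omega>\<bar> < 1 / Suc k}"
    using zero_iff_approx[OF paths t] by blast
  also have "\<dots> = (\<Inter>k::nat. \<Union>s\<in>?Q. {\<omega> \<in> space (G t). \<bar>Y s \<omega>\<bar> < 1 / Suc k})"
    by auto
  also have "\<dots> \<in> sets (G t)"
  proof -
    have "(\<Union>s\<in>?Q. {\<omega> \<in> space (G t). \<bar>Y s \<omega>\<bar> < 1 / Suc k}) \<in> sets (G t)" for k :: nat
    proof (intro sets.countable_UN'' \<open>countable ?Q\<close>)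
      fix s assume "s \<in> ?Q"
      then have [measurable]: "Y s \<in> borel_measurable (G t)" using t by (intro adapted) auto
      show "{\<omega> \<in> space (G t). \<bar>Y s \<omega>\<bar> < 1 / Suc k} \<in> sets (G t)" by measurable
    qed
    then show ?thesis by (intro sets.countable_INT) auto
  qed
  finally show ?thesis .
qed

lemma first_zero_measurable:
  fixes Y :: "real \<Rightarrow> 'a \<Rightarrow> real"
  assumes paths: "\<And>\<omega>. \<omega> \<in> space M \<Longrightarrow> continuous_on {0..} (\<lambda>t. Y t \<omega>)"
    and adapted: "\<And>s t. 0 \<le> s \<Longrightarrow> s \<le> t \<Longrightarrow> Y s \<in> borel_measurable (G t)"
    and [measurable]: "\<kappa> \<in> borel_measurable M" and nn: "\<And>\<omega>. \<omega> \<in> space M \<Longrightarrow> 0 \<le> \<kappa> \<omega>"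
  shows "(\<lambda>\<omega>. first_zero (\<lambda>t. Y t \<omega>) (\<kappa> \<omega>)) \<in> borel_measurable M"
proof (rule borel_measurableI_le)
  fix t :: real
  have eq: "{\<omega> \<in> space M. first_zero (\<lambda>t. Y t \<omega>) (\<kappa> \<omega>) \<le> t} =
      {\<omega> \<in> space M. \<exists>s\<in>{0..t}. Y s \<omega> = 0} \<union> {\<omega> \<in> space M. \<kappa> \<omega> \<le> t}"
    using first_zero(5)[OF paths nn] by auto
  have "{\<omega> \<in> space M. \<exists>s\<in>{0..t}. Y s \<omega> = 0} \<in> events"
  proof (cases "0 \<le> t")
    case True
    then show ?thesis using zero_hit_measurable[of Y t, OF paths adapted] G_subset[of t] by auto
  qed simp
  then show "{\<omega> \<in> space M. first_zero (\<lambda>t. Y t \<omega>) (\<kappa> \<omega>) \<le> t} \<in> events"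
    unfolding eq by measurable
qed

lemma bounded_stop_first_zero:
  fixes Y :: "real \<Rightarrow> 'a \<Rightarrow> real"
  assumes paths: "\<And>\<omega>. \<omega> \<in> space M \<Longrightarrow> continuous_on {0..} (\<lambda>t. Y t \<omega>)"
    and adapted: "\<And>s t. 0 \<le> s \<Longrightarrow> s \<le> t \<Longrightarrow> Y s \<in> borel_measurable (G t)"
    and \<kappa>: "bounded_stop N \<kappa>"
  shows "bounded_stop N (\<lambda>\<omega>. first_zero (\<lambda>t. Y t \<omega>) (\<kappa> \<omega>))"
  unfolding bounded_stop_def
proof safe
  have nn: "0 \<le> \<kappa> \<omega>" "\<kappa> \<omega> \<le> N" if "\<omega> \<in> space M" for \<omega> using \<kappa> that by (auto simp: bounded_stop_def)
  show "0 \<le> first_zero (\<lambda>t. Y t \<omega>) (\<kappa> \<omega>)" "first_zero (\<lambda>t. Y t \<omega>) (\<kappa> \<omega>) \<le> N" if "\<omega> \<in> space M" for \<omega>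
    using first_zero(1,2)[OF paths[OF that] nn(1)[OF that]] nn(2)[OF that] by auto
  fix t :: real assume t: "0 \<le> t"
  have "{\<omega> \<in> space M. first_zero (\<lambda>t. Y t \<omega>) (\<kappa> \<omega>) \<le> t} =
      {\<omega> \<in> space M. \<exists>s\<in>{0..t}. Y s \<omega> = 0} \<union> {\<omega> \<in> space M. \<kappa> \<omega> \<le> t}"
    using first_zero(5)[OF paths nn(1)] by auto
  also have "\<dots> \<in> sets (G t)"
    using zero_hit_measurable[of Y t, OF paths adapted t] \<kappa> t by (auto simp: bounded_stop_def)
  finally show "{\<omega> \<in> space M. first_zero (\<lambda>t. Y t \<omega>) (\<kappa> \<omega>) \<le> t} \<in> sets (G t)" .
qed

text \<open>For \<mu> \<noteq> 0 the value \<theta> = -2\<mu>/\<sigma>^2 is the nonzero root of the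
  rate in \<open>Z\<close>, so \<open>Z\<close> has no time factor and \<open>h\<close> of the
  process is affine in it. For \<mu> = 0 this root is 0 and \<open>Z\<close> degenerates to a
  constant; there \<open>nn\<close> lets the upper bound by \<open>Z 1\<close> control the absolute
  value of the stopped process.\<close>

lemma optional_stopping_h:
  assumes \<rho>: "bounded_stop N \<rho>" and N: "0 < N"
    and nn: "\<And>\<omega>. \<omega> \<in> space M \<Longrightarrow> 0 \<le> X (\<rho> \<omega>) \<omega>"
  shows "integrable M (\<lambda>\<omega>. h (X (\<rho> \<omega>) \<omega>))" and "expectation (\<lambda>\<omega>. h (X (\<rho> \<omega>) \<omega>)) = 1"
proof -
  note Z = optional_stopping_exp[OF \<rho> N]
  have "integrable M (\<lambda>\<omega>. h (X (\<rho> \<omega>) \<omega>)) \<and> expectation (\<lambda>\<omega>. h (X (\<rho> \<omega>) \<omega>)) = 1"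
  proof (cases "\<mu> = 0")
    case False
    define \<theta> where "\<theta> = - 2 * \<mu> / \<sigma>\<^sup>2"
    have "\<theta> * \<mu> + \<theta>\<^sup>2 * \<sigma>\<^sup>2 / 2 = 0"
      using sigma_pos by (simp add: \<theta>_def field_simps power2_eq_square)
    then have h: "h (X t \<omega>) = (Z \<theta> t \<omega> - 1) / (exp (\<theta> * x0) - 1)" for t \<omega>
      using False by (simp add: scale_h_def Z_def \<theta>_def)
    have "\<theta> * x0 \<noteq> 0" using False x0_pos sigma_pos by (simp add: \<theta>_def)
    then show ?thesis unfolding h using Z[of \<theta>] by (simp add: prob_space)
  next
    case True
    (* 1 + u <= exp u inside the exponential martingale identity gives phi >= 0 = phi 0 below,
       and phi'(0) = 0 is the identity for X itself. *)
    let ?X = "\<lambda>\<omega>. X (\<rho> \<omega>) \<omega>"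
    let ?c = "\<sigma>\<^sup>2 * N / 2"
    have bound: "\<theta> * ?X \<omega> \<le> Z \<theta> (\<rho> \<omega>) \<omega> - 1 + ?c * \<theta>\<^sup>2" if "\<omega> \<in> space M" for \<theta> \<omega>
    proof -
      have "1 + (\<theta> * ?X \<omega> - \<theta>\<^sup>2 * \<sigma>\<^sup>2 / 2 * \<rho> \<omega>) \<le> Z \<theta> (\<rho> \<omega>) \<omega>"
        unfolding Z_def using exp_ge_add_one_self[of "\<theta> * ?X \<omega> - \<theta>\<^sup>2 * \<sigma>\<^sup>2 / 2 * \<rho> \<omega>"] True by simp
      moreover have "\<theta>\<^sup>2 * \<sigma>\<^sup>2 / 2 * \<rho> \<omega> \<le> \<theta>\<^sup>2 * \<sigma>\<^sup>2 / 2 * N"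
        using \<rho> that by (intro mult_left_mono) (auto simp: bounded_stop_def)
      ultimately show ?thesis by (simp add: algebra_simps)
    qed
    have [measurable]: "?X \<in> borel_measurable M"
      using \<rho> by (intro X_at_measurable bounded_stop_measurable[OF \<rho>]) (auto simp: bounded_stop_def)
    have int: "integrable M ?X"
    proof (rule Bochner_Integration.integrable_bound)
      show "integrable M (\<lambda>\<omega>. Z 1 (\<rho> \<omega>) \<omega> + ?c)" using Z(1) by simp
      have "\<bar>?X \<omega>\<bar> \<le> \<bar>Z 1 (\<rho> \<omega>) \<omega> + ?c\<bar>" if "\<omega> \<in> space M" for \<omega>
        using nn[OF that] bound[OF that, of 1] by simp
      then show "AE \<omega> in M. norm (?X \<omega>) \<le> norm (Z 1 (\<rho> \<omega>) \<omega> + ?c)" by (intro AE_I2) simp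
    qed simp
    define \<phi> where "\<phi> \<theta> = exp (\<theta> * x0) - 1 + ?c * \<theta>\<^sup>2 - \<theta> * expectation ?X" for \<theta>
    have \<phi>_nn: "0 \<le> \<phi> \<theta>" for \<theta>
    proof -
      have "expectation (\<lambda>\<omega>. \<theta> * ?X \<omega>) \<le> expectation (\<lambda>\<omega>. Z \<theta> (\<rho> \<omega>) \<omega> - 1 + ?c * \<theta>\<^sup>2)"
        using int Z by (intro integral_mono bound) auto
      then show ?thesis using Z[of \<theta>] by (simp add: \<phi>_def prob_space)
    qed
    have "(\<phi> has_real_derivative (x0 - expectation ?X)) (at 0)"
      unfolding \<phi>_def by (auto intro!: derivative_eq_intros)
    moreover have "\<phi> 0 = 0" by (simp add: \<phi>_def)
    ultimately have "x0 - expectation ?X = 0"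
      using \<phi>_nn by (intro DERIV_local_min[of \<phi> _ 0 1]) auto
    then show ?thesis using int True x0_pos by (simp add: scale_h_def)
  qed
  then show "integrable M (\<lambda>\<omega>. h (X (\<rho> \<omega>) \<omega>))" "expectation (\<lambda>\<omega>. h (X (\<rho> \<omega>) \<omega>)) = 1" by auto
qed

text \<open>Turns absorption into stopping of the unabsorbed process, so that optional stopping for
  \<open>X\<close> covers the absorbed one.\<close>

lemma absorbed_eq_first_zero:
  assumes "\<omega> \<in> space M" "0 \<le> t"
  shows "absorbed W x0 \<mu> \<sigma> t \<omega> = X (first_zero (\<lambda>s. X s \<omega>) t) \<omega>"
proof (cases "\<exists>s\<in>{0..t}. X s \<omega> = 0")
  case True
  then obtain s where s: "0 \<le> s" "s \<le> t" "X s \<omega> = 0" by auto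
  note fz = first_zero[OF X_continuous[OF assms(1)] assms(2)]
  have "first_zero (\<lambda>s. X s \<omega>) t \<le> s" using s fz(5)[of s] by auto
  then have "X (first_zero (\<lambda>s. X s \<omega>) t) \<omega> = 0"
    using s fz(4) fz(2) by (cases "s = t") auto
  then show ?thesis using True by (simp add: absorbed_def)
next
  case False
  note fz = first_zero[OF X_continuous[OF assms(1)] assms(2)]
  have "first_zero (\<lambda>s. X s \<omega>) t = t" using fz(1,2,4) False by auto
  then show ?thesis using False by (simp add: absorbed_def)
qed

lemma absorbed_nonneg:
  assumes "\<omega> \<in> space M" "0 \<le> t"
  shows "0 \<le> absorbed W x0 \<mu> \<sigma> t \<omega>"
  unfolding absorbed_eq_first_zero[OF assms]
  using first_zero(1,3)[OF X_continuous[OF assms(1)] assms(2)] x0_pos X_0[OF assms(1)]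
  by (intro no_zero_pos[OF X_continuous[OF assms(1)]]) auto

lemma absorbed_measurable:
  assumes "\<kappa> \<in> borel_measurable M" "\<And>\<omega>. \<omega> \<in> space M \<Longrightarrow> 0 \<le> \<kappa> \<omega>"
  shows "(\<lambda>\<omega>. absorbed W x0 \<mu> \<sigma> (\<kappa> \<omega>) \<omega>) \<in> borel_measurable M"
proof -
  have "(\<lambda>\<omega>. X (first_zero (\<lambda>s. X s \<omega>) (\<kappa> \<omega>)) \<omega>) \<in> borel_measurable M"
    using first_zero(1)[OF X_continuous assms(2)]
    by (intro X_at_measurable first_zero_measurable X_continuous X_measurable_G assms)
  moreover have "X (first_zero (\<lambda>s. X s \<omega>) (\<kappa> \<omega>)) \<omega> = absorbed W x0 \<mu> \<sigma> (\<kappa> \<omega>) \<omega>"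
    if "\<omega> \<in> space M" for \<omega>
    using absorbed_eq_first_zero[OF that assms(2)[OF that]] by simp
  ultimately show ?thesis by (simp cong: measurable_cong)
qed

text \<open>For the last claim: capping \<tau> at \<open>Suc n\<close> and at the first zero gives a
  bounded stopping time, for which the mean of \<open>h\<close> is exactly 1. Almost every path has
  finite \<tau>, so its capped value is eventually the uncapped one, and Fatou leaves an
  inequality.\<close>

lemma attainable_law_properties:
  assumes "F \<in> attainable_laws M W U x0 \<mu> \<sigma>" "\<mu> \<le> 0"
  shows "prob_space F" "sets F = sets borel" "measure F {..<0} = 0"
    and "(\<integral>\<^sup>+x. ennreal (h x) \<partial>F) \<le> 1"
proof -
  obtain \<tau> where F: "F = distr M borel (\<lambda>\<omega>. absorbed W x0 \<mu> \<sigma> (enn2real (\<tau> \<omega>)) \<omega>)"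
    and \<tau>: "stopping_time (randomized_filtration M W U) \<tau>" and fin: "AE \<omega> in M. \<tau> \<omega> < \<infinity>"
    using assms by (auto simp: attainable_laws_def)
  let ?A = "\<lambda>\<omega>. absorbed W x0 \<mu> \<sigma> (enn2real (\<tau> \<omega>)) \<omega>"
  have [measurable]: "\<tau> \<in> borel_measurable M"
    by (rule measurable_stopping_time[OF \<tau> sets_filtration_subset]) simp
  have [measurable]: "?A \<in> borel_measurable M" by (intro absorbed_measurable) auto
  show "prob_space F" unfolding F by (rule prob_space_distr) measurable
  show "sets F = sets borel" by (simp add: F)
  have "measure F {..<0} = prob (?A -` {..<0} \<inter> space M)"
    unfolding F by (rule measure_distr) auto
  also have "?A -` {..<0} \<inter> space M = {}"
    using absorbed_nonneg[OF _ enn2real_nonneg] by (auto simp: not_le[symmetric])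
  finally show "measure F {..<0} = 0" by simp
  \<comment> \<open>The cap \<open>Suc n\<close> is positive for every \<open>n\<close>, as optional
    stopping demands of its bound.\<close>
  define \<kappa> where "\<kappa> n \<omega> = enn2real (min (\<tau> \<omega>) (ennreal (real (Suc n))))" for n \<omega>
  have \<kappa>_le: "\<kappa> n \<omega> \<le> t \<longleftrightarrow> \<tau> \<omega> \<le> ennreal t \<or> real (Suc n) \<le> t" if "0 \<le> t" for n \<omega> t
  proof (cases "\<tau> \<omega>")
    case (real r)
    then show ?thesis using that by (auto simp: \<kappa>_def ennreal_le_iff min_def simp del: of_nat_Suc)
  next
    case top
    then show ?thesis using that by (auto simp: \<kappa>_def min_def top_unique simp del: of_nat_Suc)
  qed
  have \<kappa>_stop: "bounded_stop (real (Suc n)) (\<kappa> n)" for n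
    unfolding bounded_stop_def
  proof safe
    show "0 \<le> \<kappa> n \<omega>" "\<kappa> n \<omega> \<le> real (Suc n)" for \<omega>
      using \<kappa>_le[of "real (Suc n)" n \<omega>] by (auto simp: \<kappa>_def)
    fix t :: real assume t: "0 \<le> t"
    have "{\<omega> \<in> space M. \<tau> \<omega> \<le> ennreal t} \<in> sets (G t)"
      using stopping_timeD[OF \<tau>, of "ennreal t"] by (simp add: pred_def G_def)
    moreover have "{\<omega> \<in> space M. \<kappa> n \<omega> \<le> t} =
        (if real (Suc n) \<le> t then space (G t) else {\<omega> \<in> space M. \<tau> \<omega> \<le> ennreal t})"
      using \<kappa>_le[OF t] by auto
    ultimately show "{\<omega> \<in> space M. \<kappa> n \<omega> \<le> t} \<in> sets (G t)"
      using sets.top[of "G t"] by (simp split: if_splits)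
  qed
  have \<kappa>_nn: "0 \<le> \<kappa> n \<omega>" for n \<omega> by (simp add: \<kappa>_def)
  have [measurable]: "(\<lambda>\<omega>. absorbed W x0 \<mu> \<sigma> (\<kappa> n \<omega>) \<omega>) \<in> borel_measurable M" for n
    by (intro absorbed_measurable bounded_stop_measurable[OF \<kappa>_stop] \<kappa>_nn)
  have h_nn: "0 \<le> h x" if "0 \<le> x" for x
    using strict_mono_less_eq[OF scale_h_strict_mono[OF x0_pos sigma_pos assms(2)], of 0 x] that
    by (simp add: scale_h_0)
  have one: "(\<integral>\<^sup>+\<omega>. ennreal (h (absorbed W x0 \<mu> \<sigma> (\<kappa> n \<omega>) \<omega>)) \<partial>M) = 1" for n
  proof -
    let ?\<rho> = "\<lambda>\<omega>. first_zero (\<lambda>s. X s \<omega>) (\<kappa> n \<omega>)"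
    have st: "bounded_stop (real (Suc n)) ?\<rho>"
      by (intro bounded_stop_first_zero X_continuous X_measurable_G \<kappa>_stop) auto
    have nn: "0 \<le> X (?\<rho> \<omega>) \<omega>" if "\<omega> \<in> space M" for \<omega>
      using absorbed_nonneg[OF that \<kappa>_nn] by (simp add: absorbed_eq_first_zero[OF that \<kappa>_nn])
    have "(\<integral>\<^sup>+\<omega>. ennreal (h (absorbed W x0 \<mu> \<sigma> (\<kappa> n \<omega>) \<omega>)) \<partial>M) =
        (\<integral>\<^sup>+\<omega>. ennreal (h (X (?\<rho> \<omega>) \<omega>)) \<partial>M)"
      by (intro nn_integral_cong) (simp add: absorbed_eq_first_zero \<kappa>_nn)
    also have "\<dots> = ennreal (expectation (\<lambda>\<omega>. h (X (?\<rho> \<omega>) \<omega>)))"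
      using nn by (intro nn_integral_eq_integral optional_stopping_h[OF st] AE_I2 h_nn) auto
    also have "\<dots> = 1" using optional_stopping_h(2)[OF st] nn by simp
    finally show ?thesis .
  qed
  have "(\<integral>\<^sup>+x. ennreal (h x) \<partial>F) = (\<integral>\<^sup>+\<omega>. ennreal (h (?A \<omega>)) \<partial>M)"
    unfolding F by (subst nn_integral_distr) auto
  also have "\<dots> = (\<integral>\<^sup>+\<omega>. liminf (\<lambda>n. ennreal (h (absorbed W x0 \<mu> \<sigma> (\<kappa> n \<omega>) \<omega>))) \<partial>M)"
  proof (rule nn_integral_cong_AE, use fin in eventually_elim)
    fix \<omega> assume "\<tau> \<omega> < \<infinity>"
    then obtain r where r: "\<tau> \<omega> = ennreal r" "0 \<le> r" by (cases "\<tau> \<omega>") auto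
    obtain n0 where n0: "r \<le> real n0" using real_arch_simple by blast
    have "eventually (\<lambda>n. ennreal (h (absorbed W x0 \<mu> \<sigma> (\<kappa> n \<omega>) \<omega>)) = ennreal (h (?A \<omega>))) sequentially"
      using eventually_ge_at_top[of n0]
    proof eventually_elim
      case (elim n)
      then have "r \<le> real (Suc n)" using n0 by simp
      then show ?case using r by (simp add: \<kappa>_def min_def ennreal_le_iff del: of_nat_Suc)
    qed
    then show "ennreal (h (?A \<omega>)) = liminf (\<lambda>n. ennreal (h (absorbed W x0 \<mu> \<sigma> (\<kappa> n \<omega>) \<omega>)))"
      by (intro lim_imp_Liminf[symmetric] tendsto_eventually) auto
  qed
  also have "\<dots> \<le> liminf (\<lambda>n. \<integral>\<^sup>+\<omega>. ennreal (h (absorbed W x0 \<mu> \<sigma> (\<kappa> n \<omega>) \<omega>)) \<partial>M)"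
    by (rule nn_integral_liminf) measurable
  also have "\<dots> = 1" by (simp add: one Liminf_const)
  finally show "(\<integral>\<^sup>+x. ennreal (h x) \<partial>F) \<le> 1" .
qed

text \<open>The Gaussian density of the increment up to time \<open>t\<close> is at most
  \<open>1 / sqrt t\<close>, so the motion does not stay in a bounded interval. This makes exit
  times almost surely finite.\<close>

lemma prob_X_interval_le:
  assumes t: "0 < t"
  shows "prob {\<omega> \<in> space M. a < X t \<omega> \<and> X t \<omega> < b} \<le> \<bar>b - a\<bar> / \<sigma> / sqrt t"
proof -
  let ?I = "{(a - x0 - \<mu> * t) / \<sigma> <..< (b - x0 - \<mu> * t) / \<sigma>}"
  let ?D = "\<lambda>\<omega>. W t \<omega> - W 0 \<omega>"
  have eq: "{\<omega> \<in> space M. a < X t \<omega> \<and> X t \<omega> < b} = ?D -` ?I \<inter> space M"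
    using sigma_pos W_0 by (auto simp: drifted_def field_simps)
  have dens: "normal_density 0 (sqrt (t - 0)) x \<le> 1 / sqrt t" for x
  proof -
    have "1 / sqrt (2 * pi * t) \<le> 1 / sqrt t"
      using t pi_gt3 by (intro divide_left_mono) (auto simp: mult_le_cancel_right1)
    moreover have "exp (- x\<^sup>2 / (2 * t)) \<le> 1" using t by simp
    ultimately have "1 / sqrt (2 * pi * t) * exp (- x\<^sup>2 / (2 * t)) \<le> 1 / sqrt t * 1"
      using t by (intro mult_mono) auto
    then show ?thesis using t by (simp add: normal_density_def)
  qed
  have I: "emeasure lborel ?I \<le> ennreal (\<bar>b - a\<bar> / \<sigma>)"
  proof (cases "a \<le> b")
    case True
    then show ?thesis using sigma_pos
      by (subst emeasure_lborel_Ioo) (auto simp: divide_right_mono diff_divide_distrib[symmetric])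
  next
    case False
    then have "?I = {}" using sigma_pos by (auto simp: field_simps)
    then show ?thesis by simp
  qed
  have "emeasure M (?D -` ?I \<inter> space M) =
      (\<integral>\<^sup>+x. ennreal (normal_density 0 (sqrt (t - 0)) x) * indicator ?I x \<partial>lborel)"
    using t by (intro distributed_emeasure[OF increment_distributed]) auto
  also have "\<dots> \<le> (\<integral>\<^sup>+x. ennreal (1 / sqrt t) * indicator ?I x \<partial>lborel)"
    using dens by (intro nn_integral_mono mult_right_mono ennreal_leI) auto
  also have "\<dots> = ennreal (1 / sqrt t) * emeasure lborel ?I"
    by (rule nn_integral_cmult_indicator) simp
  also have "\<dots> \<le> ennreal (1 / sqrt t) * ennreal (\<bar>b - a\<bar> / \<sigma>)"
    by (intro mult_left_mono I) simp
  finally have "emeasure M (?D -` ?I \<inter> space M) \<le> ennreal (1 / sqrt t * (\<bar>b - a\<bar> / \<sigma>))"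
    using t sigma_pos by (subst ennreal_mult) auto
  then show ?thesis
    unfolding eq emeasure_eq_measure using t sigma_pos by (subst (asm) ennreal_le_iff) (auto simp: mult.commute)
qed

text \<open>Before the exit the process lies between \<open>a\<close> and \<open>b\<close>, so
  \<open>h\<close> is bounded along it and, unlike for general stopping times, the mean of
  \<open>h\<close> equals 1 in the limit. The case \<open>a = 0\<close> is included: absorption then
  acts only at the exit itself.\<close>

lemma exit_law_attainable:
  assumes ab: "0 \<le> a" "a < x0" "x0 < b" and mu: "\<mu> \<le> 0"
  obtains F where "F \<in> attainable_laws M W U x0 \<mu> \<sigma>"
    "measure F {a} + measure F {b} = 1"
    "h a * measure F {a} + h b * measure F {b} = 1"
proof -
  \<comment> \<open>The product merges the two barriers: it is positive exactly inside the interval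
    and zero exactly at its ends, so the exit time is the first zero of one continuous
    process.\<close>
  define Y where "Y t \<omega> = (X t \<omega> - a) * (b - X t \<omega>)" for t \<omega>
  have Y_cont: "continuous_on {0..} (\<lambda>t. Y t \<omega>)" if "\<omega> \<in> space M" for \<omega>
    unfolding Y_def by (intro continuous_intros X_continuous that)
  have Y_adapted: "Y s \<in> borel_measurable (G t)" if "0 \<le> s" "s \<le> t" for s t
    unfolding Y_def[abs_def] using X_measurable_G[OF that] by measurable
  have Y_0: "0 < Y 0 \<omega>" if "\<omega> \<in> space M" for \<omega>
    using ab by (simp add: Y_def X_0 that)
  have Y_nonneg_iff: "0 \<le> Y t \<omega> \<longleftrightarrow> a \<le> X t \<omega> \<and> X t \<omega> \<le> b"
    and Y_pos_iff: "0 < Y t \<omega> \<longleftrightarrow> a < X t \<omega> \<and> X t \<omega> < b"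
    and Y_zero_iff: "Y t \<omega> = 0 \<longleftrightarrow> X t \<omega> = a \<or> X t \<omega> = b" for t \<omega>
    using ab by (auto simp: Y_def zero_le_mult_iff zero_less_mult_iff)
  define E where "E \<omega> \<longleftrightarrow> (\<exists>s\<ge>0. Y s \<omega> = 0)" for \<omega>
  define \<tau> where "\<tau> \<omega> = (if E \<omega> then ennreal (Inf {s. 0 \<le> s \<and> Y s \<omega> = 0}) else \<infinity>)" for \<omega>
  define \<rho> where "\<rho> n \<omega> = first_zero (\<lambda>t. Y t \<omega>) (real (Suc n))" for n \<omega>
  note fz = first_zero[OF Y_cont of_nat_0_le_iff[of "Suc n" for n], folded \<rho>_def]
  have Inf_zero: "0 \<le> Inf {s. 0 \<le> s \<and> Y s \<omega> = 0}" "Y (Inf {s. 0 \<le> s \<and> Y s \<omega> = 0}) \<omega> = 0"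
    "\<And>s. 0 \<le> s \<Longrightarrow> Y s \<omega> = 0 \<Longrightarrow> Inf {s. 0 \<le> s \<and> Y s \<omega> = 0} \<le> s"
    if "\<omega> \<in> space M" "E \<omega>" for \<omega>
  proof -
    let ?S = "{s. 0 \<le> s \<and> Y s \<omega> = 0}"
    have "closed {s \<in> {0..}. Y s \<omega> = 0}"
      by (intro continuous_closed_preimage_constant Y_cont that closed_atLeast)
    moreover have bdd: "bdd_below ?S" by (intro bdd_belowI[of _ 0]) auto
    ultimately have "Inf ?S \<in> ?S"
      using that by (intro closed_contains_Inf) (auto simp: E_def)
    then show "0 \<le> Inf ?S" "Y (Inf ?S) \<omega> = 0" by auto
    show "Inf ?S \<le> s" if "0 \<le> s" "Y s \<omega> = 0" for s
      using that by (intro cInf_lower bdd) auto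
  qed
  have \<tau>_le: "\<tau> \<omega> \<le> ennreal t \<longleftrightarrow> (\<exists>s\<in>{0..t}. Y s \<omega> = 0)" if "\<omega> \<in> space M" "0 \<le> t" for \<omega> t
  proof (cases "E \<omega>")
    case True
    then show ?thesis using Inf_zero[OF that(1) True] that
      by (auto simp: \<tau>_def ennreal_le_iff) (meson order_trans)
  next
    case False
    then show ?thesis by (auto simp: \<tau>_def E_def top_unique)
  qed
  have stop: "stopping_time (randomized_filtration M W U) \<tau>"
  proof
    fix t :: ennreal
    have "{\<omega> \<in> space M. \<tau> \<omega> \<le> t} \<in> sets (randomized_filtration M W U t)"
    proof (cases t)
      case (real r)
      then have "{\<omega> \<in> space M. \<tau> \<omega> \<le> t} = {\<omega> \<in> space M. \<exists>s\<in>{0..r}. Y s \<omega> = 0}"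
        using \<tau>_le by auto
      then show ?thesis
        using zero_hit_measurable[of Y r, OF Y_cont Y_adapted] real by (simp add: G_def)
    next
      case top
      then show ?thesis
        using sets.top[of "randomized_filtration M W U t"] by simp
    qed
    then show "Measurable.pred (randomized_filtration M W U t) (\<lambda>\<omega>. \<tau> \<omega> \<le> t)"
      by (simp add: pred_def)
  qed
  \<comment> \<open>A path that never exits is inside the interval at each time
    \<open>Suc n\<close>, an event of probability tending to 0.\<close>
  have E_AE: "AE \<omega> in M. E \<omega>"
  proof -
    have [measurable]: "\<tau> \<in> borel_measurable M"
      by (rule measurable_stopping_time[OF stop sets_filtration_subset]) simp
    have E_iff: "E \<omega> \<longleftrightarrow> \<tau> \<omega> < \<infinity>" for \<omega> by (simp add: \<tau>_def)
    have [measurable]: "{\<omega> \<in> space M. \<not> E \<omega>} \<in> events" unfolding E_iff by measurable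
    have bound: "prob {\<omega> \<in> space M. \<not> E \<omega>} \<le> \<bar>b - a\<bar> / \<sigma> / sqrt (real (Suc n))" for n
    proof -
      have [measurable]: "X (real (Suc n)) \<in> borel_measurable M" by (rule X_measurable) simp
      have "0 < Y (real (Suc n)) \<omega>" if "\<omega> \<in> space M" "\<not> E \<omega>" for \<omega>
      proof -
        have "0 \<le> Y (real (Suc n)) \<omega>"
          using that by (intro no_zero_pos[OF Y_cont Y_0]) (auto simp: E_def)
        moreover have "Y (real (Suc n)) \<omega> \<noteq> 0"
          using that of_nat_0_le_iff[of "Suc n"] unfolding E_def by blast
        ultimately show ?thesis by simp
      qed
      then have "{\<omega> \<in> space M. \<not> E \<omega>} \<subseteq> {\<omega> \<in> space M. a < X (real (Suc n)) \<omega> \<and> X (real (Suc n)) \<omega> < b}"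
        unfolding Y_pos_iff by blast
      then have "prob {\<omega> \<in> space M. \<not> E \<omega>} \<le>
          prob {\<omega> \<in> space M. a < X (real (Suc n)) \<omega> \<and> X (real (Suc n)) \<omega> < b}"
        by (rule finite_measure_mono) measurable
      also have "\<dots> \<le> \<bar>b - a\<bar> / \<sigma> / sqrt (real (Suc n))" by (intro prob_X_interval_le) simp
      finally show ?thesis .
    qed
    have "(\<lambda>n. \<bar>b - a\<bar> / \<sigma> / sqrt (real (Suc n))) \<longlonglongrightarrow> 0"
      by (rule real_tendsto_divide_at_top[OF tendsto_const filterlim_compose[OF sqrt_at_top
            filterlim_compose[OF filterlim_real_sequentially filterlim_Suc]]])
    then have "prob {\<omega> \<in> space M. \<not> E \<omega>} \<le> 0"
      using bound by (intro LIMSEQ_le_const) auto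
    then show ?thesis by (subst AE_iff_measurable[OF _ refl]) (auto simp: emeasure_eq_measure measure_le_0_iff)
  qed
  let ?A = "\<lambda>\<omega>. absorbed W x0 \<mu> \<sigma> (enn2real (\<tau> \<omega>)) \<omega>"
  have [measurable]: "\<tau> \<in> borel_measurable M"
    by (rule measurable_stopping_time[OF stop sets_filtration_subset]) simp
  have A_meas [measurable]: "?A \<in> borel_measurable M" by (intro absorbed_measurable) auto
  define F where "F = distr M borel ?A"
  have F: "F \<in> attainable_laws M W U x0 \<mu> \<sigma>"
  proof -
    have "AE \<omega> in M. \<tau> \<omega> < \<infinity>" using E_AE by eventually_elim (simp add: \<tau>_def)
    then show ?thesis using stop unfolding attainable_laws_def F_def by blast
  qed
  have A_eq: "?A \<omega> = X (enn2real (\<tau> \<omega>)) \<omega>" "?A \<omega> = a \<or> ?A \<omega> = b"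
    "eventually (\<lambda>n. \<rho> n \<omega> = enn2real (\<tau> \<omega>)) sequentially"
    if \<omega>: "\<omega> \<in> space M" "E \<omega>" for \<omega>
  proof -
    define T where "T = Inf {s. 0 \<le> s \<and> Y s \<omega> = 0}"
    note T = Inf_zero[OF \<omega>, folded T_def]
    have \<tau>: "enn2real (\<tau> \<omega>) = T" using \<omega> T by (simp add: \<tau>_def T_def)
    have "X s \<omega> \<noteq> 0" if "0 \<le> s" "s < T" for s
    proof -
      have "0 \<le> Y s \<omega>" using T(3) that by (intro no_zero_pos[OF Y_cont Y_0] \<omega>) force+
      moreover have "Y s \<omega> \<noteq> 0" using T(3) that by force
      ultimately have "0 < Y s \<omega>" by simp
      then show ?thesis using ab by (simp add: Y_pos_iff)
    qed
    \<comment> \<open>The only possible zero up to \<open>T\<close> is \<open>T\<close> itself, so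
      absorption does not alter the value at the exit.\<close>
    then have "X T \<omega> = 0" if "s \<in> {0..T}" "X s \<omega> = 0" for s
      using that by (cases "s = T") auto
    then have A: "?A \<omega> = X T \<omega>" unfolding \<tau> absorbed_def by auto
    show "?A \<omega> = X (enn2real (\<tau> \<omega>)) \<omega>" unfolding A unfolding \<tau> ..
    show "?A \<omega> = a \<or> ?A \<omega> = b" unfolding A using T(2) by (simp add: Y_zero_iff)
    obtain n0 where n0: "T \<le> real n0" using real_arch_simple by blast
    show "eventually (\<lambda>n. \<rho> n \<omega> = enn2real (\<tau> \<omega>)) sequentially"
      using eventually_ge_at_top[of n0]
    proof eventually_elim
      case (elim n)
      then have Tn: "T < real (Suc n)" using n0 by simp
      then have "\<rho> n \<omega> \<le> T" using fz(5)[OF \<omega>(1), of n T] T by auto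
      moreover have "T \<le> \<rho> n \<omega>"
        using T(3) fz(1)[OF \<omega>(1), of n] fz(4)[OF \<omega>(1), of n] Tn by auto
      ultimately show ?case using \<tau> by simp
    qed
  qed
  have h_mono: "h x \<le> h y" if "x \<le> y" for x y
    using strict_mono_less_eq[OF scale_h_strict_mono[OF x0_pos sigma_pos mu]] that by simp
  have h_nn: "0 \<le> h x" if "0 \<le> x" for x using h_mono[OF that] by (simp add: scale_h_0)
  have \<rho>_stop: "bounded_stop (real (Suc n)) (\<rho> n)" for n
    unfolding \<rho>_def
  proof (rule bounded_stop_first_zero[of Y, OF Y_cont Y_adapted])
    show "bounded_stop (real (Suc n)) (\<lambda>\<omega>. real (Suc n))"
      using sets.top[of "G t" for t] by (simp add: bounded_stop_def del: of_nat_Suc)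
  qed
  have X\<rho>: "a \<le> X (\<rho> n \<omega>) \<omega>" "X (\<rho> n \<omega>) \<omega> \<le> b" if "\<omega> \<in> space M" for n \<omega>
    using no_zero_pos[OF Y_cont[OF that] Y_0[OF that] fz(1)[OF that] fz(3)[OF that]]
    by (simp_all add: Y_nonneg_iff)
  note X\<rho>_nn = order_trans[OF ab(1) X\<rho>(1)]
  \<comment> \<open>The capped exit times eventually equal the exit time, and \<open>h b\<close>
    dominates.\<close>
  have "(\<lambda>n. expectation (\<lambda>\<omega>. h (X (\<rho> n \<omega>) \<omega>))) \<longlonglongrightarrow> expectation (\<lambda>\<omega>. h (?A \<omega>))"
  proof (rule integral_dominated_convergence[where w="\<lambda>_. h b"])
    show "(\<lambda>\<omega>. h (X (\<rho> n \<omega>) \<omega>)) \<in> borel_measurable M" for n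
      by (rule borel_measurable_integrable[OF optional_stopping_h(1)[OF \<rho>_stop _ X\<rho>_nn]]) auto
    show "AE \<omega> in M. (\<lambda>n. h (X (\<rho> n \<omega>) \<omega>)) \<longlonglongrightarrow> h (?A \<omega>)"
      using E_AE AE_space
    proof eventually_elim
      case (elim \<omega>)
      then show ?case using A_eq(3)[of \<omega>]
        by (intro tendsto_eventually) (auto elim: eventually_mono simp: A_eq(1))
    qed
    show "AE \<omega> in M. norm (h (X (\<rho> n \<omega>) \<omega>)) \<le> h b" for n
      using h_mono[OF X\<rho>(2)] h_nn[OF X\<rho>_nn] by (intro AE_I2) simp
  qed auto
  moreover have "expectation (\<lambda>\<omega>. h (X (\<rho> n \<omega>) \<omega>)) = 1" for n
    by (rule optional_stopping_h(2)[OF \<rho>_stop _ X\<rho>_nn]) auto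
  ultimately have hA: "expectation (\<lambda>\<omega>. h (?A \<omega>)) = 1"
    by (simp add: LIMSEQ_const_iff)
  have mF: "measure F {x} = prob (?A -` {x} \<inter> space M)" for x
    unfolding F_def by (rule measure_distr) auto
  have two_pt: "AE \<omega> in M. f (?A \<omega>) = f a * indicator (?A -` {a} \<inter> space M) \<omega> +
      f b * indicator (?A -` {b} \<inter> space M) \<omega>" for f :: "real \<Rightarrow> real"
    using E_AE AE_space
  proof eventually_elim
    case (elim \<omega>)
    then show ?case using A_eq(2)[of \<omega>] ab by (auto simp: indicator_def)
  qed
  \<comment> \<open>Used with the constant 1 and with \<open>h\<close>, this yields the two
    equations for the masses.\<close>
  have E_two_pt: "expectation (\<lambda>\<omega>. f (?A \<omega>)) = f a * measure F {a} + f b * measure F {b}"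
    if [measurable]: "f \<in> borel_measurable borel" for f :: "real \<Rightarrow> real"
  proof -
    have "expectation (\<lambda>\<omega>. f (?A \<omega>)) = expectation (\<lambda>\<omega>. f a * indicator (?A -` {a} \<inter> space M) \<omega> +
      f b * indicator (?A -` {b} \<inter> space M) \<omega>)"
      by (rule integral_cong_AE[OF _ _ two_pt]) measurable
    also have "\<dots> = f a * measure F {a} + f b * measure F {b}"
      by (subst Bochner_Integration.integral_add) (auto simp: mF emeasure_eq_measure)
    finally show ?thesis .
  qed
  show ?thesis
  proof (rule that[OF F])
    show "measure F {a} + measure F {b} = 1" using E_two_pt[of "\<lambda>_. 1"] by (simp add: prob_space)
    show "h a * measure F {a} + h b * measure F {b} = 1" using E_two_pt[of h] hA by simp
  qed
qed

end


section \<open>Equilibria and performance\<close>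

lemma LBINT_reflect:
  fixes f :: "real \<Rightarrow> real"
  shows "(LBINT y:{p..q}. f (1 - y)) = (LBINT r:{1 - q..1 - p}. f r)"
proof -
  have "(LBINT r:{1 - q..1 - p}. f r) =
      (\<integral>y. indicator {1 - q..1 - p} (1 + (- 1) * y) *\<^sub>R f (1 + (- 1) * y) \<partial>lborel)"
    unfolding set_lebesgue_integral_def
    by (subst lborel_integral_real_affine[where c="-1" and t=1]) simp_all
  also have "\<dots> = (LBINT y:{p..q}. f (1 - y))"
    unfolding set_lebesgue_integral_def
    by (intro Bochner_Integration.integral_cong) (auto simp: indicator_def)
  finally show ?thesis by simp
qed

text \<open>In the reflected variable the reward is \<open>1 / \<alpha>\<close> above
  \<open>1 - \<alpha>\<close> and 0 below, with primitive
  \<open>max y (1 - \<alpha>) / \<alpha>\<close>.\<close>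

lemma LBINT_optimal_reward:
  assumes "0 < \<alpha>" "\<alpha> < 1" "0 \<le> p" "p \<le> q" "q \<le> 1"
  shows "(LBINT y:{p..q}. optimal_reward \<alpha> (1 - y)) = (max q (1 - \<alpha>) - max p (1 - \<alpha>)) / \<alpha>"
proof -
  have "(LBINT y:{p..q}. optimal_reward \<alpha> (1 - y)) =
      (\<integral>y. 1 / \<alpha> * indicator ({p..q} \<inter> {1 - \<alpha><..}) y \<partial>lborel)"
    unfolding set_lebesgue_integral_def optimal_reward_def using assms
    by (intro Bochner_Integration.integral_cong) (auto simp: indicator_def)
  also have "\<dots> = 1 / \<alpha> * measure lborel ({p..q} \<inter> {1 - \<alpha><..})"
    by simp
  also have "{p..q} \<inter> {1 - \<alpha><..} = (if p \<le> 1 - \<alpha> then {1 - \<alpha><..q} else {p..q})"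
    by auto
  also have "1 / \<alpha> * measure lborel \<dots> = (max q (1 - \<alpha>) - max p (1 - \<alpha>)) / \<alpha>"
    using assms by (auto simp: max_def measure_def)
  finally show ?thesis .
qed

lemma normalized_optimal_reward:
  assumes \<alpha>: "0 < \<alpha>" "\<alpha> < 1" and R: "\<And>r. r \<in> {0..1} \<Longrightarrow> R r = optimal_reward \<alpha> r"
  shows "normalized_reward R"
proof -
  have Rv: "R r = (if r < \<alpha> then 1 / \<alpha> else 0)" if "r \<in> {0..1}" for r
    using R[OF that] that by (auto simp: optimal_reward_def indicator_def)
  have "antimono_on {0..1} R"
    using \<alpha> by (intro monotone_onI) (auto simp: Rv)
  moreover have "continuous (at_right r) R" if r: "r \<in> {0..<1}" for r
  proof -
    let ?u = "if r < \<alpha> then \<alpha> else 1"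
    have "\<forall>\<^sub>F x in at_right r. x \<in> {r<..<?u}"
      using r by (intro eventually_at_right_real) auto
    then have "\<forall>\<^sub>F x in at_right r. R x = R r"
      by eventually_elim (use r \<alpha> in \<open>auto simp: Rv split: if_splits\<close>)
    then show ?thesis by (simp add: continuous_within tendsto_eventually)
  qed
  moreover have "(R \<longlongrightarrow> R 1) (at_left 1)"
  proof -
    have "\<forall>\<^sub>F x in at_left 1. x \<in> {\<alpha><..<1}"
      using \<alpha> by (intro eventually_at_left_real)
    then have "\<forall>\<^sub>F x in at_left 1. R x = R 1"
      by eventually_elim (use \<alpha> in \<open>auto simp: Rv\<close>)
    then show ?thesis by (rule tendsto_eventually)
  qed
  moreover have "(LBINT r:{0..1}. R r) = 1"
  proof -
    have "(LBINT r:{0..1}. R r) = (LBINT r:{0..1}. optimal_reward \<alpha> r)"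
      by (intro set_lebesgue_integral_cong) (auto simp: R)
    also have "\<dots> = (LBINT y:{0..1}. optimal_reward \<alpha> (1 - y))"
      by (simp add: LBINT_reflect[of 0 1])
    also have "\<dots> = 1" using LBINT_optimal_reward[of \<alpha> 0 1] \<alpha> by simp
    finally show ?thesis .
  qed
  ultimately show ?thesis
    using \<alpha> by (auto simp: normalized_reward_def reward_function_def Rv)
qed

section \<open>Quantiles and rank rewards of one distribution\<close>

context real_distribution
begin

lemma measure_singleton: "measure M {x} = cdf M x - measure M {..<x}"
  unfolding cdf_def ivl_disj_un(2)[symmetric] by (subst finite_measure_Union) auto

lemma measure_greaterThan: "measure M {x<..} = 1 - cdf M x"
  using prob_compl[of "{..x}"] by (simp add: cdf_def Compl_eq_Diff_UNIV[symmetric])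

lemma measure_atLeast: "measure M {x..} = 1 - measure M {..<x}"
  using prob_compl[of "{..<x}"] by (simp add: Compl_eq_Diff_UNIV[symmetric])

lemma integrable_indicator_borel [simp, intro]:
  "A \<in> sets borel \<Longrightarrow> integrable M (indicat_real A)"
  by (simp add: emeasure_eq_measure)

lemma measure_lessThan_le_cdf: "measure M {..<x} \<le> cdf M x"
  unfolding cdf_def by (intro finite_measure_mono) auto

lemma cdf_le_measure_lessThan: "x < y \<Longrightarrow> cdf M x \<le> measure M {..<y}"
  unfolding cdf_def by (intro finite_measure_mono) auto

text \<open>The performance is a (1 - \<alpha>)-quantile, so the cdf crosses the level
  \<open>1 - \<alpha>\<close> there, possibly by a jump. Without mass on the negative axis,
  restricting the infimum to \<open>0 \<le> x\<close> does not move the crossing.\<close>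

lemma performance_properties:
  assumes \<alpha>: "0 < \<alpha>" "\<alpha> < 1" and nonneg: "measure M {..<0} = 0"
  defines "a \<equiv> performance \<alpha> M"
  shows "0 \<le> a" "x < a \<Longrightarrow> cdf M x \<le> 1 - \<alpha>" "a < x \<Longrightarrow> 1 - \<alpha> < measure M {..<x}"
    "measure M {..<a} \<le> 1 - \<alpha>" "1 - \<alpha> \<le> cdf M a"
proof -
  let ?S = "{x. 0 \<le> x \<and> 1 - \<alpha> < cdf M x}"
  have a: "a = Inf ?S" by (simp add: a_def performance_def)
  have "\<forall>\<^sub>F x in at_top. 1 - \<alpha> < cdf M x"
    using \<alpha> by (intro order_tendstoD(1)[OF cdf_lim_at_top_prob]) simp
  then have "\<forall>\<^sub>F x in at_top. 0 \<le> x \<and> 1 - \<alpha> < cdf M x"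
    using eventually_ge_at_top[of "0::real"] by eventually_elim simp
  from eventually_happens'[OF trivial_limit_at_top_linorder this] have ne: "?S \<noteq> {}" by simp
  have bdd: "bdd_below ?S" by (intro bdd_belowI[of _ 0]) auto
  show "0 \<le> a" unfolding a by (intro cInf_greatest ne) auto
  show below: "cdf M x \<le> 1 - \<alpha>" if "x < a" for x
  proof (cases "0 \<le> x")
    case True
    show ?thesis
    proof (rule ccontr)
      assume "\<not> cdf M x \<le> 1 - \<alpha>"
      then have "a \<le> x" unfolding a using True by (intro cInf_lower[OF _ bdd]) simp
      then show False using that by simp
    qed
  next
    case False
    then have "cdf M x = 0"
      using cdf_le_measure_lessThan[of x 0] nonneg cdf_nonneg[of x] by simp
    then show ?thesis using \<alpha> by simp
  qed
  show above: "1 - \<alpha> < measure M {..<x}" if "a < x" for x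
  proof -
    have "Inf ?S < x" using that by (simp only: a)
    from cInf_lessD[OF ne this] obtain y where "y \<in> ?S" "y < x" by blast
    then show ?thesis using cdf_le_measure_lessThan[of y x] by simp
  qed
  show "measure M {..<a} \<le> 1 - \<alpha>"
  proof (rule tendsto_upperbound[OF cdf_at_left])
    have "\<forall>\<^sub>F x in at_left a. x \<in> {a - 1<..<a}" by (rule eventually_at_left_real) simp
    then show "\<forall>\<^sub>F x in at_left a. cdf M x \<le> 1 - \<alpha>"
      by eventually_elim (simp add: below)
  qed simp
  show "1 - \<alpha> \<le> cdf M a"
  proof (rule tendsto_lowerbound)
    show "(cdf M \<longlongrightarrow> cdf M a) (at_right a)"
      using cdf_is_right_cont[of a] by (simp add: continuous_within)
    have "\<forall>\<^sub>F x in at_right a. x \<in> {a<..<a + 1}" by (rule eventually_at_right_real) simp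
    then show "\<forall>\<^sub>F x in at_right a. 1 - \<alpha> \<le> cdf M x"
    proof eventually_elim
      case (elim x)
      then show ?case using above[of x] measure_lessThan_le_cdf[of x] by simp
    qed
  qed simp
qed

text \<open>Positions below the quantile hold only unrewarded ranks, positions above it only
  rewarded ones. The value \<open>c\<close> at the quantile depends on how an atom there straddles
  rank \<alpha>, so only its product with the atom's mass is recorded. The total is 1 because the
  players share the whole reward among themselves.\<close>

lemma expected_optimal_reward:
  assumes \<alpha>: "0 < \<alpha>" "\<alpha> < 1" and nonneg: "measure M {..<0} = 0"
  defines "a \<equiv> performance \<alpha> M"
  obtains c where "0 \<le> c" "c * measure M {a} = (cdf M a - (1 - \<alpha>)) / \<alpha>"
    "expected_reward (optimal_reward \<alpha>) M =
      (\<lambda>x. c * indicator {a} x + 1 / \<alpha> * indicator {a<..} x)"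
    "(\<integral>x. expected_reward (optimal_reward \<alpha>) M x \<partial>M) = 1"
proof -
  note perf = performance_properties[OF \<alpha> nonneg, folded a_def]
  define c where "c = expected_reward (optimal_reward \<alpha>) M a"
  have avg: "(LBINT y:{measure M {..<x}..cdf M x}. optimal_reward \<alpha> (1 - y)) =
      (max (cdf M x) (1 - \<alpha>) - max (measure M {..<x}) (1 - \<alpha>)) / \<alpha>" for x
    using measure_lessThan_le_cdf cdf_bounded_prob \<alpha> by (intro LBINT_optimal_reward) auto
  have c1: "c * measure M {a} = (cdf M a - (1 - \<alpha>)) / \<alpha>"
    using perf(4,5) measure_lessThan_le_cdf[of a] unfolding measure_singleton c_def expected_reward_def avg
    by (auto simp: optimal_reward_def max_def)
  have c0: "0 \<le> c"
    using perf(4,5) measure_lessThan_le_cdf[of a] \<alpha> unfolding c_def expected_reward_def avg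
    by (auto simp: optimal_reward_def max_def intro!: divide_nonneg_nonneg)
  have \<xi>: "expected_reward (optimal_reward \<alpha>) M x = c * indicator {a} x + 1 / \<alpha> * indicator {a<..} x" for x
  proof (cases x a rule: linorder_cases)
    case less
    then show ?thesis
      using perf(2)[OF less] measure_lessThan_le_cdf[of x] \<alpha> unfolding expected_reward_def avg
      by (auto simp: optimal_reward_def max_def)
  next
    case equal
    then show ?thesis by (simp add: c_def)
  next
    case greater
    then show ?thesis
      using perf(3)[OF greater] measure_lessThan_le_cdf[of x] cdf_bounded_prob[of x] \<alpha>
      unfolding expected_reward_def avg
      by (auto simp: optimal_reward_def max_def field_simps)
  qed
  have "(\<integral>x. expected_reward (optimal_reward \<alpha>) M x \<partial>M) =
      c * measure M {a} + 1 / \<alpha> * measure M {a<..}"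
    unfolding \<xi> by (subst Bochner_Integration.integral_add) (auto simp: emeasure_eq_measure)
  also have "\<dots> = 1" unfolding c1 measure_greaterThan using \<alpha> by (simp add: field_simps)
  finally have "(\<integral>x. expected_reward (optimal_reward \<alpha>) M x \<partial>M) = 1" .
  then show ?thesis using that c0 c1 \<xi> by blast
qed

lemma expected_reward_cong:
  assumes "\<And>r. r \<in> {0..1} \<Longrightarrow> R r = R' r"
  shows "expected_reward R M = expected_reward R' M"
proof
  fix x
  have "0 \<le> y" if "measure M {..<x} \<le> y" for y
    using measure_nonneg that by (rule order_trans)
  then have "(LBINT y:{measure M {..<x}..cdf M x}. R (1 - y)) =
      (LBINT y:{measure M {..<x}..cdf M x}. R' (1 - y))"
    using cdf_bounded_prob[of x]
    by (intro set_lebesgue_integral_cong) (auto intro!: assms)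
  then show "expected_reward R M x = expected_reward R' M x"
    using cdf_bounded_prob[of x] cdf_nonneg[of x] by (simp add: expected_reward_def assms)
qed

lemma integral_two_point:
  assumes ab: "a \<noteq> b" "measure M {a} + measure M {b} = 1"
    and [measurable]: "f \<in> borel_measurable borel"
  shows "(\<integral>x. f x \<partial>M) = f a * measure M {a} + f b * measure M {b}"
proof -
  have "measure M {a, b} = 1"
    using ab finite_measure_Union[of "{a}" "{b}"] by (simp add: insert_is_Un[of a "{b}"])
  then have "AE x in M. x \<in> {a, b}" by (subst AE_in_set_eq_1) auto
  then have "AE x in M. f x = f a * indicator {a} x + f b * indicator {b} x"
    by eventually_elim (use ab in \<open>auto simp: indicator_def\<close>)
  then have "(\<integral>x. f x \<partial>M) = (\<integral>x. f a * indicator {a} x + f b * indicator {b} x \<partial>M)"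
    by (intro integral_cong_AE) auto
  also have "\<dots> = f a * measure M {a} + f b * measure M {b}"
    by (subst Bochner_Integration.integral_add) (auto simp: emeasure_eq_measure)
  finally show ?thesis .
qed

end

text \<open>Interface between the process and the game. The two equations in \<open>exit_law\<close>
  give \<open>b\<close> the mass (1 - \<open>h a\<close>)/(\<open>h b\<close> - \<open>h a\<close>),
  so these laws are explicit deviations against which an equilibrium can be tested.\<close>

locale exit_laws =
  fixes \<F> :: "real measure set" and h :: "real \<Rightarrow> real" and x0 \<alpha> xs :: real
  assumes h_strict: "strict_mono h" and h_cont: "continuous_on UNIV h"
    and h_0: "h 0 = 0" and h_x0: "h x0 = 1" and x0_pos: "0 < x0"
    and \<alpha>: "0 < \<alpha>" "\<alpha> < 1" and xs: "h xs = 1 / \<alpha>"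
    and law_distribution: "\<And>F. F \<in> \<F> \<Longrightarrow> real_distribution F"
    and law_nonneg: "\<And>F. F \<in> \<F> \<Longrightarrow> measure F {..<0} = 0"
    and law_h: "\<And>F. F \<in> \<F> \<Longrightarrow> (\<integral>\<^sup>+x. ennreal (h x) \<partial>F) \<le> 1"
    and exit_law: "\<And>a b. 0 \<le> a \<Longrightarrow> a < x0 \<Longrightarrow> x0 < b \<Longrightarrow>
      \<exists>F\<in>\<F>. measure F {a} + measure F {b} = 1 \<and> h a * measure F {a} + h b * measure F {b} = 1"
begin

lemma h_less_iff: "h x < h y \<longleftrightarrow> x < y"
  using h_strict by (rule strict_mono_less)

lemma h_le_iff: "h x \<le> h y \<longleftrightarrow> x \<le> y"
  using h_strict by (rule strict_mono_less_eq)

lemma h_measurable [measurable]: "h \<in> borel_measurable borel"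
  using h_cont by (rule borel_measurable_continuous_onI)

lemma x0_less_xs: "x0 < xs"
  using h_less_iff[of x0 xs] \<alpha> by (simp add: xs h_x0)

lemma h_nonneg_iff: "0 \<le> h x \<longleftrightarrow> 0 \<le> x"
  using h_le_iff[of 0 x] by (simp add: h_0)

lemma law_AE_nonneg:
  assumes "F \<in> \<F>"
  shows "AE x in F. 0 \<le> x"
proof -
  interpret real_distribution F by (rule law_distribution[OF assms])
  have "measure F {0..} = 1" by (simp add: measure_atLeast law_nonneg[OF assms])
  then have "AE x in F. x \<in> {0..}" by (subst AE_in_set_eq_1) auto
  then show ?thesis by simp
qed

lemma law_integrable_h:
  assumes "F \<in> \<F>"
  shows "integrable F h" "(\<integral>x. h x \<partial>F) \<le> 1"
proof -
  interpret real_distribution F by (rule law_distribution[OF assms])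
  have nn: "AE x in F. 0 \<le> h x" using law_AE_nonneg[OF assms] by (simp add: h_nonneg_iff)
  show int: "integrable F h"
    using law_h[OF assms] nn by (intro integrableI_nonneg) (auto intro: le_less_trans)
  show "(\<integral>x. h x \<partial>F) \<le> 1"
    using law_h[OF assms] nn by (simp add: nn_integral_eq_integral[OF int nn])
qed

lemma law_tail:
  assumes "F \<in> \<F>" "0 \<le> c"
  shows "h c * measure F {c..} \<le> 1"
proof -
  interpret real_distribution F by (rule law_distribution[OF assms(1)])
  have "(\<integral>x. h c * indicator {c..} x \<partial>F) \<le> (\<integral>x. h x \<partial>F)"
  proof (rule integral_mono_AE)
    show "AE x in F. h c * indicator {c..} x \<le> h x"
      using law_AE_nonneg[OF assms(1)] by eventually_elim (auto simp: indicator_def h_le_iff h_nonneg_iff)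
  qed (use law_integrable_h[OF assms(1)] in auto)
  then show ?thesis using law_integrable_h[OF assms(1)] by simp
qed

lemma performance_le:
  assumes "F \<in> \<F>"
  shows "performance \<alpha> F \<le> xs"
proof (rule ccontr)
  interpret real_distribution F by (rule law_distribution[OF assms])
  let ?a = "performance \<alpha> F"
  note perf = performance_properties[OF \<alpha> law_nonneg[OF assms]]
  assume "\<not> ?a \<le> xs"
  then have "1 / \<alpha> < h ?a" by (simp add: xs[symmetric] h_less_iff)
  \<comment> \<open>The left limit at the quantile is at most \<open>1 - \<alpha>\<close>, so the
    half-line including a possible atom at \<open>?a\<close> carries mass at least \<alpha>.\<close>
  moreover have "\<alpha> \<le> measure F {?a..}" using perf(4) by (simp add: measure_atLeast)
  ultimately have "1 / \<alpha> * \<alpha> < h ?a * measure F {?a..}"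
    using \<alpha> by (intro mult_less_le_imp_less) auto
  then show False using law_tail[OF assms perf(1)] \<alpha> by simp
qed

definition optimal_cdf :: "real \<Rightarrow> real" where
  "optimal_cdf = (\<lambda>x. (1 - \<alpha>) * indicator {0..<xs} x + indicator {xs..} x)"

text \<open>Equality case of Markov's inequality, and the common criterion for recognizing F*: it is
  applied to the exit law from (0, \<open>xs\<close>), to equilibria of the optimal reward and to
  equilibria of a maximizing reward.\<close>

lemma cdf_eq_optimal_cdf:
  assumes F: "F \<in> \<F>" and tail: "measure F {..<xs} \<le> 1 - \<alpha>"
  shows "cdf F = optimal_cdf"
proof -
  interpret real_distribution F by (rule law_distribution[OF F])
  note int = law_integrable_h[OF F]
  let ?d = "\<lambda>x. h x - h xs * indicator {xs..} x"
  have d_nn: "AE x in F. 0 \<le> ?d x"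
    using law_AE_nonneg[OF F] by eventually_elim (auto simp: indicator_def h_le_iff h_nonneg_iff)
  have d_int: "integrable F ?d" using int by auto
  have d_eq: "(\<integral>x. ?d x \<partial>F) = (\<integral>x. h x \<partial>F) - 1 / \<alpha> * measure F {xs..}"
    using int by (subst Bochner_Integration.integral_diff) (auto simp: xs)
  \<comment> \<open>The nonnegative gap \<open>?d\<close> has integral at most 1 - 1, which pins
    down both the tail mass and the support: \<open>h\<close> vanishes only at 0.\<close>
  have "1 \<le> 1 / \<alpha> * measure F {xs..}" using tail \<alpha> by (simp add: measure_atLeast field_simps)
  moreover have "0 \<le> (\<integral>x. ?d x \<partial>F)" using d_nn by (rule integral_nonneg_AE)
  ultimately have "(\<integral>x. ?d x \<partial>F) = 0" "1 / \<alpha> * measure F {xs..} = 1"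
    using d_eq int(2) by linarith+
  then have m: "measure F {..<xs} = 1 - \<alpha>" and "AE x in F. ?d x = 0"
    using integral_nonneg_eq_0_iff_AE[OF d_int d_nn] \<alpha> by (auto simp: measure_atLeast field_simps)
  from this(2) have two: "AE x in F. x = 0 \<or> x = xs"
  proof eventually_elim
    case (elim x)
    then show ?case
      using h_less_iff[of x xs] h_less_iff[of xs x] h_less_iff[of x 0] h_less_iff[of 0 x]
      by (cases "xs \<le> x") (auto simp: h_0 not_less)
  qed
  show ?thesis
  proof
    fix x
    consider "x < 0" | "0 \<le> x" "x < xs" | "xs \<le> x" by linarith
    then show "cdf F x = optimal_cdf x"
    proof cases
      case 1
      then have "cdf F x = 0"
        using cdf_le_measure_lessThan[of x 0] law_nonneg[OF F] cdf_nonneg[of x] by simp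
      then show ?thesis using 1 x0_less_xs x0_pos by (simp add: optimal_cdf_def)
    next
      case 2
      have "measure F {..x} = measure F {..<xs}"
        using 2 by (intro finite_measure_eq_AE eventually_mono[OF two]) auto
      then show ?thesis using 2 m by (simp add: optimal_cdf_def cdf_def)
    next
      case 3
      have "measure F {..x} = measure F (space F)"
        using 3 x0_less_xs x0_pos by (intro finite_measure_eq_AE eventually_mono[OF two]) auto
      then show ?thesis unfolding prob_space using 3 by (simp add: optimal_cdf_def cdf_def)
    qed
  qed
qed

lemma optimal_cdf_properties:
  assumes F: "F \<in> \<F>" "cdf F = optimal_cdf"
  shows "performance \<alpha> F = xs" "x \<le> 0 \<Longrightarrow> measure F {..<x} = 0"
    "0 < x \<Longrightarrow> x \<le> xs \<Longrightarrow> measure F {..<x} = 1 - \<alpha>" "xs < x \<Longrightarrow> measure F {..<x} = 1"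
proof -
  interpret real_distribution F by (rule law_distribution[OF F(1)])
  have pos: "0 < xs" using x0_less_xs x0_pos by simp
  \<comment> \<open>The plateau has height exactly \<open>1 - \<alpha>\<close>; the strict
    inequality in \<open>performance\<close> is what skips it.\<close>
  have "{x. 0 \<le> x \<and> 1 - \<alpha> < cdf F x} = {xs..}"
    using \<alpha> pos by (auto simp: F(2) optimal_cdf_def indicator_def split: if_splits)
  then show "performance \<alpha> F = xs" by (simp add: performance_def)
  have lim: "measure F {..<x} = l" if "y < x" "\<And>z. y < z \<Longrightarrow> z < x \<Longrightarrow> cdf F z = l" for x y l
  proof (rule tendsto_unique[OF _ cdf_at_left])
    have "\<forall>\<^sub>F z in at_left x. cdf F z = l"
      using eventually_at_left_real[OF that(1)] by eventually_elim (auto intro: that(2))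
    then show "(cdf F \<longlongrightarrow> l) (at_left x)" by (rule tendsto_eventually)
  qed simp
  show "x \<le> 0 \<Longrightarrow> measure F {..<x} = 0"
    using pos by (intro lim[of "x - 1"]) (auto simp: F(2) optimal_cdf_def)
  show "0 < x \<Longrightarrow> x \<le> xs \<Longrightarrow> measure F {..<x} = 1 - \<alpha>"
    by (intro lim[of 0]) (auto simp: F(2) optimal_cdf_def)
  show "xs < x \<Longrightarrow> measure F {..<x} = 1"
    by (intro lim[of xs]) (auto simp: F(2) optimal_cdf_def)
qed

lemma optimal_law_exists: "\<exists>F\<in>\<F>. cdf F = optimal_cdf"
proof -
  obtain F where F: "F \<in> \<F>" "measure F {0} + measure F {xs} = 1"
    "h 0 * measure F {0} + h xs * measure F {xs} = 1"
    using exit_law[of 0 xs] x0_pos x0_less_xs by auto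
  interpret real_distribution F by (rule law_distribution[OF F(1)])
  have "\<alpha> = measure F {xs}" using F(3) \<alpha> by (simp add: h_0 xs field_simps)
  also have "\<dots> \<le> measure F {xs..}" by (intro finite_measure_mono) auto
  finally show ?thesis using cdf_eq_optimal_cdf[OF F(1)] F(1) by (auto simp: measure_atLeast)
qed

text \<open>The expected reward becomes \<open>1 / \<alpha>\<close> on \<open>{xs..}\<close> and 0
  elsewhere, so the best-response inequality is Markov's inequality at \<open>xs\<close>.\<close>

lemma equilibrium_if_optimal_cdf:
  assumes F: "F \<in> \<F>" "cdf F = optimal_cdf"
  shows "mean_field_equilibrium \<F> (optimal_reward \<alpha>) F"
proof -
  interpret real_distribution F by (rule law_distribution[OF F(1)])
  note opt = optimal_cdf_properties[OF F]
  have pos: "0 < xs" using x0_less_xs x0_pos by simp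
  obtain c where c: "c * measure F {xs} = (cdf F xs - (1 - \<alpha>)) / \<alpha>"
    "expected_reward (optimal_reward \<alpha>) F = (\<lambda>x. c * indicator {xs} x + 1 / \<alpha> * indicator {xs<..} x)"
    "(\<integral>x. expected_reward (optimal_reward \<alpha>) F x \<partial>F) = 1"
    using expected_optimal_reward[OF \<alpha> law_nonneg[OF F(1)], unfolded opt(1)] by metis
  have "cdf F xs = 1" by (simp add: F(2) optimal_cdf_def)
  \<comment> \<open>The atom at \<open>xs\<close> has mass \<alpha> and occupies exactly the
    rewarded ranks.\<close>
  then have "c = 1 / \<alpha>" using c(1) opt(3)[of xs] pos \<alpha> by (simp add: measure_singleton field_simps)
  then have \<xi>: "expected_reward (optimal_reward \<alpha>) F = (\<lambda>x. 1 / \<alpha> * indicator {xs..} x)"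
    unfolding c(2) by (auto simp: indicator_def)
  show ?thesis
    unfolding mean_field_equilibrium_def c(3)
  proof (intro conjI ballI F(1))
    fix F' assume F': "F' \<in> \<F>"
    interpret F': real_distribution F' by (rule law_distribution[OF F'])
    show "(\<integral>x. expected_reward (optimal_reward \<alpha>) F x \<partial>F') \<le> 1"
      unfolding \<xi> using law_tail[OF F', of xs] pos by (simp add: xs)
  qed
qed

lemma optimal_cdf_if_equilibrium:
  assumes "mean_field_equilibrium \<F> (optimal_reward \<alpha>) F"
  shows "cdf F = optimal_cdf"
proof -
  have F: "F \<in> \<F>" using assms by (simp add: mean_field_equilibrium_def)
  interpret real_distribution F by (rule law_distribution[OF F])
  let ?a = "performance \<alpha> F"
  note perf = performance_properties[OF \<alpha> law_nonneg[OF F]]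
  obtain c where c: "0 \<le> c"
    "expected_reward (optimal_reward \<alpha>) F = (\<lambda>x. c * indicator {?a} x + 1 / \<alpha> * indicator {?a<..} x)"
    "(\<integral>x. expected_reward (optimal_reward \<alpha>) F x \<partial>F) = 1"
    using expected_optimal_reward[OF \<alpha> law_nonneg[OF F]] by metis
  have "xs \<le> ?a"
  proof (rule ccontr)
    assume "\<not> xs \<le> ?a"
    \<comment> \<open>Above \<open>?a\<close>, so that stopping at \<open>b\<close> earns the full
      \<open>1 / \<alpha>\<close>; above \<open>x0\<close>, so that \<open>b\<close> is an upper
      exit point; below \<open>xs\<close>, so that \<open>b\<close> is reached with probability
      \<open>1 / h b\<close>, more than \<alpha>.\<close>
    then obtain b where b: "max ?a x0 < b" "b < xs"
      using dense[of "max ?a x0" xs] x0_less_xs by auto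
    then obtain F' where F': "F' \<in> \<F>" "measure F' {0} + measure F' {b} = 1"
      "h 0 * measure F' {0} + h b * measure F' {b} = 1"
      using exit_law[of 0 b] x0_pos by auto
    interpret F': real_distribution F' by (rule law_distribution[OF F'(1)])
    have hb: "h b < 1 / \<alpha>" "0 < h b" using b x0_pos h_less_iff[of 0 b] by (auto simp: xs[symmetric] h_less_iff h_0)
    have "1 < 1 / \<alpha> * measure F' {b}"
    proof -
      have "measure F' {b} = 1 / h b" using F'(3) hb by (simp add: h_0 field_simps)
      moreover have "1 < 1 / \<alpha> * (1 / h b)" using hb \<alpha> by (simp add: field_simps)
      ultimately show ?thesis by (simp only:)
    qed
    \<comment> \<open>The payoff at 0 can be \<open>c\<close> when \<open>?a = 0\<close>; it is
      nonnegative in any case.\<close>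
    also have "\<dots> \<le> (c * indicator {?a} 0 + 1 / \<alpha> * indicator {?a<..} 0) * measure F' {0} +
        (c * indicator {?a} b + 1 / \<alpha> * indicator {?a<..} b) * measure F' {b}"
      using b c(1) \<alpha> by (auto simp: indicator_def)
    also have "\<dots> = (\<integral>x. expected_reward (optimal_reward \<alpha>) F x \<partial>F')"
      unfolding c(2) using b x0_pos by (intro F'.integral_two_point[symmetric] F'(2)) auto
    also have "\<dots> \<le> 1"
      using assms F'(1) unfolding mean_field_equilibrium_def c(3) by blast
    finally show False by simp
  qed
  then have "measure F {..<xs} \<le> measure F {..<?a}" by (intro finite_measure_mono) auto
  then show ?thesis using perf(4) by (intro cdf_eq_optimal_cdf F) simp
qed

lemma equilibrium_optimal_iff:
  "mean_field_equilibrium \<F> (optimal_reward \<alpha>) F \<longleftrightarrow> F \<in> \<F> \<and> cdf F = optimal_cdf"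
  using equilibrium_if_optimal_cdf optimal_cdf_if_equilibrium
  by (auto simp: mean_field_equilibrium_def)

lemma equilibrium_cong:
  assumes "\<And>r. r \<in> {0..1} \<Longrightarrow> R r = R' r"
  shows "mean_field_equilibrium \<F> R F \<longleftrightarrow> mean_field_equilibrium \<F> R' F"
  unfolding mean_field_equilibrium_def
  using real_distribution.expected_reward_cong[OF law_distribution, of F R R'] assms by metis

text \<open>Under F* the reward takes few values: averages over the ranks above and below \<alpha>
  at the two atoms, R(\<alpha>) on the plateau between them, R(0) beyond \<open>xs\<close>. Each
  test against an exit law is a linear inequality between these numbers.\<close>

lemma reward_eq_optimal_if_equilibrium:
  assumes R: "normalized_reward R" and F: "mean_field_equilibrium \<F> R F" "cdf F = optimal_cdf"
    and r: "r \<in> {0..1}"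
  shows "R r = optimal_reward \<alpha> r"
proof -
  have FF: "F \<in> \<F>" using F by (simp add: mean_field_equilibrium_def)
  interpret real_distribution F by (rule law_distribution[OF FF])
  note opt = optimal_cdf_properties[OF FF F(2)]
  have pos: "0 < xs" using x0_less_xs x0_pos by simp
  have R_nn: "\<And>r. r \<in> {0..1} \<Longrightarrow> 0 \<le> R r" and R_mono: "antimono_on {0..1} R"
    and R_lim: "(R \<longlongrightarrow> R 1) (at_left 1)" and R_1: "R 1 = 0" and R_int: "(LBINT r:{0..1}. R r) = 1"
    using R by (auto simp: normalized_reward_def reward_function_def)
  have R_anti: "R s \<le> R r" if "0 \<le> r" "r \<le> s" "s \<le> 1" for r s
    using monotone_onD[OF R_mono, of r s] that by simp
  (* The integral of a non-integrable function is 0, so integrability follows from R_int. *)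
  have R_integrable: "set_integrable lborel {0..1} R"
    using R_int not_integrable_integral_eq[of lborel "\<lambda>x. indicator {0..1} x *\<^sub>R R x"]
    unfolding set_integrable_def set_lebesgue_integral_def by auto
  have R_sub: "set_integrable lborel {p..q} R" if "0 \<le> p" "q \<le> 1" for p q
    using that by (intro set_integrable_subset[OF R_integrable]) auto
  define I1 where "I1 = (LBINT r:{\<alpha>..1}. R r)"
  define I2 where "I2 = (LBINT r:{0..\<alpha>}. R r)"
  have split: "(LBINT r:{p..q}. R r) = (LBINT r:{p..s}. R r) + (LBINT r:{s..q}. R r)"
    if "0 \<le> p" "p \<le> s" "s \<le> q" "q \<le> 1" for p q s
  proof -
    have "(LBINT r:{p..s} \<union> {s..q}. R r) = (LBINT r:{p..s}. R r) + (LBINT r:{s..q}. R r)"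
      using that by (intro set_integral_Un_AE R_sub eventually_mono[OF AE_lborel_singleton[of s]]) auto
    then show ?thesis using that by (simp add: ivl_disj_un)
  qed
  have const_int: "set_integrable lborel {p..q} (\<lambda>_. k)" "p \<le> q \<Longrightarrow> (LBINT r:{p..q}. k) = k * (q - p)" for p q k :: real
    unfolding set_integrable_def set_lebesgue_integral_def
    by (auto simp: emeasure_lborel_Icc_eq)
  have upper: "(LBINT r:{p..q}. R r) \<le> k * (q - p)" 
    if "0 \<le> p" "p \<le> q" "q \<le> 1" "\<And>r. r \<in> {p..q} \<Longrightarrow> R r \<le> k" for p q k
    using set_integral_mono[OF R_sub const_int(1), of p q k] that by (simp add: const_int(2))
  have lower: "0 \<le> (LBINT r:{p..q}. R r)" if "0 \<le> p" "p \<le> q" "q \<le> 1" for p q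
    using set_integral_mono[OF const_int(1) R_sub, of p q 0] that R_nn by (simp add: const_int(2))
  have I_sum: "I1 + I2 = 1" using split[of 0 \<alpha> 1] \<alpha> R_int by (simp add: I1_def I2_def)
  define \<xi> where "\<xi> x = (if x < 0 then R 1 else if x = 0 then I1 / (1 - \<alpha>) else
    if x < xs then R \<alpha> else if x = xs then I2 / \<alpha> else R 0)" for x
  have \<xi>: "expected_reward R F = \<xi>"
  proof
    fix x
    consider "x < 0" | "x = 0" | "0 < x" "x < xs" | "x = xs" | "xs < x" by linarith
    then show "expected_reward R F x = \<xi> x"
      using opt(2-4)[of x] pos \<alpha>
      by cases (auto simp: expected_reward_def \<xi>_def F(2) optimal_cdf_def LBINT_reflect I1_def I2_def)
  qed
  have [measurable]: "\<xi> \<in> borel_measurable borel" unfolding \<xi>_def[abs_def] by measurable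
  have m0: "measure F {0} = 1 - \<alpha>" and mxs: "measure F {xs} = \<alpha>"
    using opt(2)[of 0] opt(3)[of xs] pos by (simp_all add: measure_singleton F(2) optimal_cdf_def)
  have "(\<integral>x. \<xi> x \<partial>F) = \<xi> 0 * (1 - \<alpha>) + \<xi> xs * \<alpha>"
    using integral_two_point[of 0 xs \<xi>] m0 mxs pos by simp
  also have "\<dots> = 1" using \<alpha> pos I_sum by (simp add: \<xi>_def)
  finally have \<xi>_F: "(\<integral>x. \<xi> x \<partial>F) = 1" .
  \<comment> \<open>The best-response inequality against the exit law from (\<open>a\<close>,
    \<open>b\<close>), multiplied by \<open>h b - h a\<close> to clear the denominators of the two
    masses.\<close>
  have test: "\<xi> a * (h b - 1) + \<xi> b * (1 - h a) \<le> h b - h a" if ab: "0 \<le> a" "a < x0" "x0 < b" for a b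
  proof -
    obtain F' where F': "F' \<in> \<F>" "measure F' {a} + measure F' {b} = 1"
      "h a * measure F' {a} + h b * measure F' {b} = 1"
      using exit_law[OF ab] by auto
    interpret F': real_distribution F' by (rule law_distribution[OF F'(1)])
    have "\<xi> a * measure F' {a} + \<xi> b * measure F' {b} = (\<integral>x. \<xi> x \<partial>F')"
      using ab by (intro F'.integral_two_point[symmetric] F'(2)) auto
    also have "\<dots> \<le> 1"
      using F(1) F'(1) unfolding mean_field_equilibrium_def \<xi> \<xi>_F by blast
    finally have le: "\<xi> a * measure F' {a} + \<xi> b * measure F' {b} \<le> 1" .
    have hab: "0 < h b - h a" using ab h_less_iff[of a b] by simp
    have ma: "measure F' {a} = 1 - measure F' {b}" using F'(2) by simp
    have "h a * (1 - measure F' {b}) + h b * measure F' {b} = 1" using F'(3) unfolding ma .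
    then have mb': "measure F' {b} * (h b - h a) = 1 - h a" by (simp add: algebra_simps)
    have ma': "measure F' {a} * (h b - h a) = h b - 1" unfolding ma using mb' by (simp add: algebra_simps)
    have "(\<xi> a * measure F' {a} + \<xi> b * measure F' {b}) * (h b - h a) \<le> 1 * (h b - h a)"
      using le hab by (intro mult_right_mono) auto
    then show ?thesis by (simp only: distrib_right mult.assoc ma' mb' mult_1)
  qed
  have h_lim: "(h \<longlongrightarrow> h x) (at_right x)" for x
    using h_cont by (simp add: continuous_on_def filterlim_at_split)
  have R\<alpha>_le: "R \<alpha> * (1 - \<alpha>) \<le> I1"
  proof -
    \<comment> \<open>Taking \<open>a = 0\<close> would compare F* with itself. Points just above 0
      earn R(\<alpha>) instead of the average \<open>I1 / (1 - \<alpha>)\<close>, at a vanishing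
      change of the exit probabilities.\<close>
    have "R \<alpha> * (h xs - 1) + I2 / \<alpha> * (1 - h 0) \<le> h xs - h 0"
    proof (rule tendsto_le)
      show "((\<lambda>x. R \<alpha> * (h xs - 1) + I2 / \<alpha> * (1 - h x)) \<longlongrightarrow>
          R \<alpha> * (h xs - 1) + I2 / \<alpha> * (1 - h 0)) (at_right 0)"
        by (intro tendsto_intros h_lim)
      show "((\<lambda>x. h xs - h x) \<longlongrightarrow> h xs - h 0) (at_right 0)"
        by (intro tendsto_intros h_lim)
      have "\<forall>\<^sub>F x in at_right 0. x \<in> {0<..<x0}" using x0_pos by (rule eventually_at_right_real)
      then show "\<forall>\<^sub>F x in at_right 0. R \<alpha> * (h xs - 1) + I2 / \<alpha> * (1 - h x) \<le> h xs - h x"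
      proof eventually_elim
        case (elim x)
        then show ?case using test[of x xs] x0_less_xs pos by (simp add: \<xi>_def)
      qed
    qed simp
    then have "\<alpha> * (R \<alpha> * (1 / \<alpha> - 1) + I2 / \<alpha>) \<le> \<alpha> * (1 / \<alpha>)"
      using \<alpha> by (intro mult_left_mono) (auto simp: h_0 xs)
    then have "R \<alpha> * (1 - \<alpha>) + I2 \<le> 1" using \<alpha> by (simp add: algebra_simps)
    then show ?thesis using I_sum by simp
  qed
  have R\<alpha>: "R \<alpha> = 0"
  proof (rule ccontr)
    assume "R \<alpha> \<noteq> 0"
    then have b: "0 < R \<alpha>" using R_nn[of \<alpha>] \<alpha> by simp
    have "\<forall>\<^sub>F s in at_left 1. R s < R \<alpha> / 2"
      using b R_1 by (intro order_tendstoD(2)[OF R_lim]) simp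
    moreover have "\<forall>\<^sub>F s in at_left 1. s \<in> {\<alpha><..<1}" using \<alpha> by (intro eventually_at_left_real)
    ultimately have "\<forall>\<^sub>F s in at_left 1. R s < R \<alpha> / 2 \<and> s \<in> {\<alpha><..<1}" by (rule eventually_conj)
    \<comment> \<open>Since R(1-) = 0, the reward falls well below R(\<alpha>) before rank 1, and by
      monotonicity stays there. The mean over [\<alpha>,1] is then strictly below R(\<alpha>),
      contradicting \<open>R\<alpha>_le\<close>.\<close>
    then obtain s where s: "R s < R \<alpha> / 2" "\<alpha> < s" "s < 1"
      using eventually_happens'[OF trivial_limit_at_left_real] by fastforce
    have "I1 = (LBINT r:{\<alpha>..s}. R r) + (LBINT r:{s..1}. R r)"
      using s \<alpha> by (simp add: I1_def split[of \<alpha> s 1])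
    also have "\<dots> \<le> R \<alpha> * (s - \<alpha>) + R s * (1 - s)"
      using s \<alpha> R_anti by (intro add_mono upper) auto
    also have "\<dots> < R \<alpha> * (s - \<alpha>) + R \<alpha> * (1 - s)"
      using s b by (intro add_strict_left_mono mult_strict_right_mono) auto
    finally show False using R\<alpha>_le by (simp add: algebra_simps)
  qed
  have zero: "R s = 0" if "\<alpha> \<le> s" "s \<le> 1" for s
    using R_anti[of \<alpha> s] R_nn[of s] that \<alpha> R\<alpha> by simp
  have "I1 \<le> 0" unfolding I1_def using upper[of \<alpha> 1 0] zero \<alpha> by simp
  then have I1: "I1 = 0" using lower[of \<alpha> 1] \<alpha> by (simp add: I1_def)
  have R0: "R 0 \<le> 1 / \<alpha>"
  proof -
    \<comment> \<open>At \<open>xs\<close> the payoff is the average \<open>I2 / \<alpha>\<close>;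
      just beyond it a deviator outranks everyone and earns R(0). The payoff at 0 vanishes because
      \<open>I1 = 0\<close>.\<close>
    have "R 0 \<le> h xs"
    proof (rule tendsto_lowerbound[OF h_lim])
      have "\<forall>\<^sub>F x in at_right xs. x \<in> {xs<..<xs + 1}" by (rule eventually_at_right_real) simp
      then show "\<forall>\<^sub>F x in at_right xs. R 0 \<le> h x"
      proof eventually_elim
        case (elim x)
        then show ?case using test[of 0 x] x0_less_xs x0_pos pos I1 by (simp add: \<xi>_def h_0)
      qed
    qed simp
    then show ?thesis by (simp add: xs)
  qed
  have one: "R s = 1 / \<alpha>" if s: "0 \<le> s" "s < \<alpha>" for s
  proof (rule antisym)
    show "R s \<le> 1 / \<alpha>" using R_anti[of 0 s] R0 s \<alpha> by simp
    have "1 = (LBINT r:{0..s}. R r) + (LBINT r:{s..\<alpha>}. R r)"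
      using s \<alpha> I_sum I1 by (simp add: I2_def split[of 0 s \<alpha>])
    \<comment> \<open>The upper bound is used before \<open>s\<close>, and monotonicity after it.
      This yields equality at each single rank, where comparing integrals alone would give it only
      almost everywhere.\<close>
    also have "\<dots> \<le> 1 / \<alpha> * (s - 0) + R s * (\<alpha> - s)"
      using s \<alpha> R_anti R0 by (intro add_mono upper) (auto intro: order_trans[OF _ R0])
    finally have "(1 / \<alpha>) * (\<alpha> - s) \<le> R s * (\<alpha> - s)" using \<alpha> by (simp add: right_diff_distrib)
    then show "1 / \<alpha> \<le> R s" using s by (simp only: mult_le_cancel_right)
  qed
  show ?thesis
    using r zero one by (cases "r < \<alpha>") (auto simp: optimal_reward_def)
qed

text \<open>For the converse, a maximizer is compared with the optimal reward, whose equilibrium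
  attains \<open>xs\<close>. Its own equilibrium therefore has performance at least
  \<open>xs\<close>, hence is F*, and F* determines the reward on [0,1].\<close>

lemma maximizes_performance_iff:
  "maximizes_performance \<F> \<alpha> R \<longleftrightarrow> (\<forall>r\<in>{0..1}. R r = optimal_reward \<alpha> r)"
proof
  assume R: "\<forall>r\<in>{0..1}. R r = optimal_reward \<alpha> r"
  have eq: "mean_field_equilibrium \<F> R F \<longleftrightarrow> F \<in> \<F> \<and> cdf F = optimal_cdf" for F
    using equilibrium_cong[of R "optimal_reward \<alpha>" F] R equilibrium_optimal_iff by blast
  show "maximizes_performance \<F> \<alpha> R"
    unfolding maximizes_performance_def eq
  proof (intro conjI allI impI)
    show "normalized_reward R" using R by (intro normalized_optimal_reward[OF \<alpha>]) auto
    show "\<exists>F. F \<in> \<F> \<and> cdf F = optimal_cdf" using optimal_law_exists by blast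
    fix F R' F'
    assume "(F \<in> \<F> \<and> cdf F = optimal_cdf) \<and> normalized_reward R' \<and> mean_field_equilibrium \<F> R' F'"
    then show "performance \<alpha> F' \<le> performance \<alpha> F"
      using optimal_cdf_properties(1)[of F] performance_le[of F'] by (simp add: mean_field_equilibrium_def)
  qed
next
  assume "maximizes_performance \<F> \<alpha> R"
  then obtain F where R: "normalized_reward R" and F: "mean_field_equilibrium \<F> R F"
    and max: "\<And>R' F'. normalized_reward R' \<Longrightarrow> mean_field_equilibrium \<F> R' F' \<Longrightarrow>
      performance \<alpha> F' \<le> performance \<alpha> F"
    unfolding maximizes_performance_def by blast
  have FF: "F \<in> \<F>" using F by (simp add: mean_field_equilibrium_def)
  interpret real_distribution F by (rule law_distribution[OF FF])
  obtain F0 where F0: "F0 \<in> \<F>" "cdf F0 = optimal_cdf" using optimal_law_exists by blast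
  have "xs \<le> performance \<alpha> F"
    using max[OF normalized_optimal_reward[OF \<alpha>] equilibrium_if_optimal_cdf[OF F0]]
      optimal_cdf_properties(1)[OF F0] by simp
  then have "measure F {..<xs} \<le> measure F {..<performance \<alpha> F}"
    by (intro finite_measure_mono) auto
  then have "cdf F = optimal_cdf"
    using performance_properties(4)[OF \<alpha> law_nonneg[OF FF]] by (intro cdf_eq_optimal_cdf FF) simp
  then show "\<forall>r\<in>{0..1}. R r = optimal_reward \<alpha> r"
    using reward_eq_optimal_if_equilibrium[OF R F] by blast
qed

lemma equilibrium_optimal_unique: "\<exists>!F. mean_field_equilibrium \<F> (optimal_reward \<alpha>) F"
  unfolding equilibrium_optimal_iff
  using optimal_law_exists cdf_unique[OF law_distribution law_distribution] by metis

end

theorem theorem4p1: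
  fixes M :: "'a measure" and W :: "real \<Rightarrow> 'a \<Rightarrow> real" and U :: "'a \<Rightarrow> real"
    and x0 \<mu> \<sigma> \<alpha> :: real
  defines "\<F> \<equiv> attainable_laws M W U x0 \<mu> \<sigma>"
    and "xstar \<equiv> the_inv_into {0..} (scale_h x0 \<mu> \<sigma>) (1 / \<alpha>)"
  assumes "standard_brownian_motion M W" and "randomizer M W U"
    and "0 < x0" and "0 < \<sigma>" and "\<mu> \<le> 0" and "0 < \<alpha>" and "\<alpha> < 1"
  shows "(\<forall>R. maximizes_performance \<F> \<alpha> R \<longleftrightarrow> (\<forall>r\<in>{0..1}. R r = optimal_reward \<alpha> r)) \<and>
    (\<exists>!F. mean_field_equilibrium \<F> (optimal_reward \<alpha>) F) \<and>
    (\<forall>F. mean_field_equilibrium \<F> (optimal_reward \<alpha>) F \<longrightarrow>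
       performance \<alpha> F = xstar \<and>
       cdf F = (\<lambda>x. (1 - \<alpha>) * indicator {0..<xstar} x + indicator {xstar..} x))"
proof -
  interpret drifted_motion M W U x0 \<mu> \<sigma>
    using assms by unfold_locales
  note params = \<open>0 < x0\<close> \<open>0 < \<sigma>\<close>
  have h_mono: "strict_mono h" by (rule scale_h_strict_mono[OF params \<open>\<mu> \<le> 0\<close>])
  obtain xs where xs: "0 \<le> xs" "h xs = 1 / \<alpha>"
    using scale_h_surj[OF params \<open>\<mu> \<le> 0\<close>, of "1 / \<alpha>"] \<open>0 < \<alpha>\<close> by auto
  \<comment> \<open>Injectivity of \<open>h\<close> identifies the inverse in the statement with the
    preimage found by surjectivity.\<close>
  have "xstar = xs"
    unfolding xstar_def
    by (rule the_inv_into_f_eq) (use xs h_mono in \<open>auto intro: inj_on_subset dest: strict_mono_imp_inj_on\<close>)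
  interpret exit_laws \<F> h x0 \<alpha> xs
  proof (rule exit_laws.intro)
    show "real_distribution F" if "F \<in> \<F>" for F
      using attainable_law_properties(1,2)[OF that[unfolded \<F>_def] \<open>\<mu> \<le> 0\<close>]
      by (simp add: real_distribution_def real_distribution_axioms_def)
    show "measure F {..<0} = 0" "(\<integral>\<^sup>+x. ennreal (h x) \<partial>F) \<le> 1" if "F \<in> \<F>" for F
      using attainable_law_properties(3,4)[OF that[unfolded \<F>_def] \<open>\<mu> \<le> 0\<close>] by auto
    show "\<exists>F\<in>\<F>. measure F {a} + measure F {b} = 1 \<and> h a * measure F {a} + h b * measure F {b} = 1"
      if "0 \<le> a" "a < x0" "x0 < b" for a b
      using exit_law_attainable[OF that \<open>\<mu> \<le> 0\<close>] unfolding \<F>_def by blast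
  qed (use assms xs in \<open>auto intro!: h_mono scale_h_continuous simp: scale_h_0 scale_h_x0\<close>)
  have "performance \<alpha> F = xs \<and> cdf F = optimal_cdf"
    if "mean_field_equilibrium \<F> (optimal_reward \<alpha>) F" for F
    using that optimal_cdf_properties(1) unfolding equilibrium_optimal_iff by blast
  then show ?thesis
    unfolding \<open>xstar = xs\<close>
    using maximizes_performance_iff equilibrium_optimal_unique by (simp add: optimal_cdf_def)
qed

end
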